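(* Let $\{X_n\}_{n\in\mathbb Z}$ be a real-valued, doubly infinite, stationary and ergodic time series, and assume that for some number $D$, $|X_0|\le D<\infty$ almost surely. Let the estimators $R_k$ ($k\ge1$) and $\hat R_{-t}$ ($t\ge1$) be constructed as described in the context, and let $\mathbf X^-=(X_{-1},X_{-2},\dots)$. Then $$\lim_{k\to\infty}R_k=E(X_0\mid\mathbf X^-)\quad\text{a.s.}$$ and $$\lim_{t\to\infty}\hat R_{-t}=E(X_0\mid\mathbf X^-)\quad\text{a.s.}$$
   Context: Notation: for $i\le j$, $X_i^j=(X_i,X_{i+1},\dots,X_j)$. Partitions and quantizers: $\mathcal P_k=\{A_{k,i}: i=1,\dots,m_k\}$, $k\ge1$, is a sequence of finite partitions of the real line into (finite or infinite) right semi-closed intervals such that the finite $\sigma$-algebras $\sigma(\mathcal P_k)$ are increasing in $k$ and asymptotically generate the Borel $\sigma$-field (i.e. $\bigcup_k\sigma(\mathcal P_k)$ generates it). The quantizer $G_k$ is defined by $G_k(x)=A_{k,i}$ if $x\in A_{k,i}$, and it is applied to vectors coordinatewise. Recursive construction: put $\lambda_0=1$, and for $k=1,2,\dots$ let $$\tau_k=\min\{t>0:\ G_k(X_{-\lambda_{k-1}-t}^{-1-t})=G_k(X_{-\lambda_{k-1}}^{-1})\},\qquad \lambda_k=\tau_k+\lambda_{k-1}.$$ Here $t$ ranges over positive integers; by ergodicity all $\tau_k$ are a.s. finite. Estimators: $$R_k=\frac1k\sum_{1\le j\le k}X_{-\tau_j}.$$ For an integer $t>0$, let $\kappa_t$ be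 the maximum of the integers $k$ for which $\lambda_k\le t$, and put $$\hat R_{-t}=\frac1{\kappa_t}\sum_{1\le j\le\kappa_t}X_{-\tau_j}$$ (a.s. $\kappa_t\ge1$ for all large $t$, so the value when $\kappa_t=0$ is irrelevant to the limit). *)

theory Defs
  imports "HOL-Probability.Probability"
begin

abbreviation path_space :: "(int \<Rightarrow> real) measure" where
  "path_space \<equiv> (\<Pi>\<^sub>M n\<in>UNIV. borel)"

definition stationary :: "'a measure \<Rightarrow> (int \<Rightarrow> 'a \<Rightarrow> real) \<Rightarrow> bool" where
  "stationary M X \<longleftrightarrow>
     (\<forall>m. distr M path_space (\<lambda>\<omega> n. X (n + m) \<omega>) = distr M path_space (\<lambda>\<omega> n. X n \<omega>))"

text \<open>Ergodicity is a property of the law of the process: every event of path space that is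
  invariant under the time shift has probability zero or one.\<close>

definition ergodic :: "'a measure \<Rightarrow> (int \<Rightarrow> 'a \<Rightarrow> real) \<Rightarrow> bool" where
  "ergodic M X \<longleftrightarrow>
     (\<forall>S \<in> sets path_space. (\<lambda>x n. x (n + 1)) -` S = S \<longrightarrow>
        measure M {\<omega> \<in> space M. (\<lambda>n. X n \<omega>) \<in> S} \<in> {0, 1})"

definition right_semiclosed :: "real set \<Rightarrow> bool" where
  "right_semiclosed I \<longleftrightarrow>
     (\<exists>a b. I = {a<..b}) \<or> (\<exists>b. I = {..b}) \<or> (\<exists>a. I = {a<..}) \<or> I = UNIV"

text \<open>Partitions are indexed from 1 on; the value of the sequence at 0 is never used.\<close>

definition partition_sequence :: "(nat \<Rightarrow> real set set) \<Rightarrow> bool" where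
  "partition_sequence P \<longleftrightarrow>
     (\<forall>k\<ge>1. partition_on UNIV (P k) \<and> finite (P k) \<and> (\<forall>A\<in>P k. right_semiclosed A)) \<and>
     (\<forall>k\<ge>1. sigma_sets UNIV (P k) \<subseteq> sigma_sets UNIV (P (Suc k))) \<and>
     sigma_sets UNIV (\<Union>k\<in>{1..}. sigma_sets UNIV (P k)) = sets borel"

definition quantizer :: "real set set \<Rightarrow> real \<Rightarrow> real set" where
  "quantizer Q x = (THE A. A \<in> Q \<and> x \<in> A)"

definition block :: "(int \<Rightarrow> real) \<Rightarrow> int \<Rightarrow> int \<Rightarrow> real list" where
  "block x i j = map x [i..j]"

text \<open>The minimum below is unspecified on paths whose last \<open>l\<close> quantized values never recur.\<close>

definition recurrence_time :: "real set set \<Rightarrow> (int \<Rightarrow> real) \<Rightarrow> nat \<Rightarrow> nat" where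
  "recurrence_time Q x l = (LEAST t. t > 0 \<and>
     map (quantizer Q) (block x (- int l - int t) (- 1 - int t)) =
     map (quantizer Q) (block x (- int l) (- 1)))"

primrec lam :: "(nat \<Rightarrow> real set set) \<Rightarrow> (int \<Rightarrow> real) \<Rightarrow> nat \<Rightarrow> nat" where
  "lam P x 0 = 1"
| "lam P x (Suc k) = recurrence_time (P (Suc k)) x (lam P x k) + lam P x k"

definition tau :: "(nat \<Rightarrow> real set set) \<Rightarrow> (int \<Rightarrow> real) \<Rightarrow> nat \<Rightarrow> nat" where
  "tau P x k = recurrence_time (P k) x (lam P x (k - 1))"

lemma lam_step: "k \<ge> 1 \<Longrightarrow> lam P x k = tau P x k + lam P x (k - 1)"
  by (cases k) (simp_all add: tau_def)

definition R :: "(nat \<Rightarrow> real set set) \<Rightarrow> (int \<Rightarrow> real) \<Rightarrow> nat \<Rightarrow> real" where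
  "R P x k = (1 / real k) * (\<Sum>j=1..k. x (- int (tau P x j)))"

definition kappa :: "(nat \<Rightarrow> real set set) \<Rightarrow> (int \<Rightarrow> real) \<Rightarrow> nat \<Rightarrow> nat" where
  "kappa P x t = (GREATEST k. lam P x k \<le> t)"

definition R_hat :: "(nat \<Rightarrow> real set set) \<Rightarrow> (int \<Rightarrow> real) \<Rightarrow> nat \<Rightarrow> real" where
  "R_hat P x t = (1 / real (kappa P x t)) * (\<Sum>j=1..kappa P x t. x (- int (tau P x j)))"

text \<open>The \<open>\<sigma>\<close>-algebra generated by the sequence \<open>(X\<^sub>-\<^sub>1, X\<^sub>-\<^sub>2, \<dots>)\<close>.\<close>

definition past :: "'a measure \<Rightarrow> (int \<Rightarrow> 'a \<Rightarrow> real) \<Rightarrow> 'a measure" where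
  "past M X = vimage_algebra (space M) (\<lambda>\<omega> n. X (- 1 - int n) \<omega>) (\<Pi>\<^sub>M n\<in>(UNIV::nat set). borel)"

end

theory Submission
  imports Defs
begin

text \<open>
  Fix \<open>k\<close> and look at the paths on which the quantized values of \<open>X\<^sub>-\<^sub>1, \<dots>, X\<^sub>-\<^sub>l\<close> form a given
  pattern \<open>b\<close>, where \<open>l = \<lambda>\<^sub>k\<close>. The window length is itself read off from the pattern, so this is a
  cylinder \<open>A\<close> of path space, and \<open>\<tau>\<^sub>k\<^sub>+\<^sub>1\<close> is the first time at which the backward shift brings the
  path back to \<open>A\<close>. The first-return map of a measure-preserving invertible transformation preserves
  the measure on \<open>A\<close> (\<open>first_return_preserves_integral\<close>). Hence, given the quantized past
  \<open>F\<^sub>k\<close>, the random variable \<open>X\<close> at time \<open>-\<tau>\<^sub>k\<^sub>+\<^sub>1\<close> has the same conditional law as \<open>X\<^sub>0\<close>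
  (\<open>conditional_law_of_return_fibre\<close>).

  Let \<open>h\<^sub>k\<close> replace a value by a representative of its cell, and let \<open>V\<^sub>k\<close> be \<open>h\<^sub>k\<close> applied to
  \<open>X\<close> at time \<open>-\<tau>\<^sub>k\<^sub>+\<^sub>1\<close>. This \<open>V\<^sub>k\<close> is known at the next stage, because \<open>\<tau>\<^sub>k\<^sub>+\<^sub>1 \<le> \<lambda>\<^sub>k\<^sub>+\<^sub>1\<close>. Subtracting
  \<open>E(h\<^sub>k(X\<^sub>0) | F\<^sub>k)\<close> therefore leaves bounded martingale differences, whose averages tend to zero
  (\<open>bounded_martingale_difference_slln\<close>). A generating sequence of interval partitions
  separates points, so its mesh on \<open>[-D, D]\<close> tends to zero (\<open>mesh_tendsto_0\<close>), and the error made by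
  replacing \<open>x\<close> by \<open>h\<^sub>k(x)\<close> tends to zero uniformly. Levy's upward theorem (\<open>levy_upward\<close>) gives
  \<open>E(X\<^sub>0 | F\<^sub>k) \<rightarrow> E(X\<^sub>0 | F\<^sub>\<infinity>)\<close> almost surely, and averaging preserves the limit. Since
  \<open>\<lambda>\<^sub>k\<close> grows without bound and the cells generate the Borel sets, \<open>F\<^sub>\<infinity>\<close> agrees with the past
  up to null sets (\<open>cond_exp_past\<close>). This proves the first limit. The second estimator is the first one
  evaluated at \<open>\<kappa>\<^sub>t\<close>, which tends to infinity.
\<close>

section \<open>Averages of real sequences\<close>

lemma cesaro_null:
  fixes a :: "nat \<Rightarrow> real"
  assumes "a \<longlonglongrightarrow> 0"
  shows "(\<lambda>n. (\<Sum>j<n. a j) / real n) \<longlonglongrightarrow> 0"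
proof (rule LIMSEQ_I)
  fix e :: real assume e: "e > 0"
  from LIMSEQ_D[OF assms half_gt_zero[OF e]] obtain N where N: "\<And>n. n \<ge> N \<Longrightarrow> \<bar>a n\<bar> < e / 2"
    by auto
  define C where "C = (\<Sum>j<N. \<bar>a j\<bar>)"
  have bnd: "\<bar>\<Sum>j<n. a j\<bar> \<le> C + real n * (e / 2)" for n
  proof -
    have "\<bar>\<Sum>j<n. a j\<bar> \<le> (\<Sum>j<n. \<bar>a j\<bar>)" by simp
    also have "\<dots> \<le> (\<Sum>j<n. (if j < N then \<bar>a j\<bar> else 0) + e / 2)"
      using N e by (intro sum_mono) (force simp: not_less intro: less_imp_le)
    also have "\<dots> = (\<Sum>j\<in>{..<n} \<inter> {..<N}. \<bar>a j\<bar>) + real n * (e / 2)"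
      by (simp add: sum.distrib sum.inter_restrict)
    also have "(\<Sum>j\<in>{..<n} \<inter> {..<N}. \<bar>a j\<bar>) \<le> C"
      unfolding C_def by (intro sum_mono2) auto
    finally show ?thesis by simp
  qed
  obtain M where M: "real M > C / (e / 2)" using reals_Archimedean2 by blast
  show "\<exists>no. \<forall>n\<ge>no. norm ((\<Sum>j<n. a j) / real n - 0) < e"
  proof (intro exI[of _ "Suc M"] allI impI)
    fix n assume n: "Suc M \<le> n"
    then have "real M \<le> real n" by simp
    with M have "C / (e / 2) < real n" by linarith
    then have "C < real n * (e / 2)" using e by (simp only: pos_divide_less_eq half_gt_zero)
    with bnd[of n] have "\<bar>\<Sum>j<n. a j\<bar> < real n * e" by linarith
    with n show "norm ((\<Sum>j<n. a j) / real n - 0) < e" by (simp add: field_simps)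
  qed
qed

lemma cesaro_limit:
  fixes a :: "nat \<Rightarrow> real"
  assumes "a \<longlonglongrightarrow> L"
  shows "(\<lambda>n. (\<Sum>j<n. a j) / real n) \<longlonglongrightarrow> L"
proof -
  have "(\<lambda>n. (\<Sum>j<n. a j - L) / real n) \<longlonglongrightarrow> 0"
    using assms by (intro cesaro_null) (simp add: LIM_zero)
  then have "(\<lambda>n. (\<Sum>j<n. a j - L) / real n + L) \<longlonglongrightarrow> 0 + L"
    by (intro tendsto_intros)
  then have *: "(\<lambda>n. (\<Sum>j<n. a j - L) / real n + L) \<longlonglongrightarrow> L" by simp
  show ?thesis
    by (rule Lim_transform_eventually[OF *], rule eventually_sequentiallyI[of 1])
       (simp add: sum_subtractf field_simps)
qed

text \<open>Between consecutive squares \<open>m\<^sup>2 \<le> n < (m + 1)\<^sup>2\<close> there are at most \<open>2 m\<close> steps of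
  size \<open>K\<close>, which is negligible against \<open>n\<close>.\<close>

lemma square_subsequence_interpolation:
  fixes s :: "nat \<Rightarrow> real"
  assumes step: "\<And>n. \<bar>s (Suc n) - s n\<bar> \<le> K"
    and lim: "(\<lambda>n. s (n\<^sup>2) / real (n\<^sup>2)) \<longlonglongrightarrow> 0"
  shows "(\<lambda>n. s n / real n) \<longlonglongrightarrow> 0"
proof (rule LIMSEQ_I)
  fix e :: real assume e: "e > 0"
  have K: "K \<ge> 0" using step[of 0] by linarith
  have diff: "\<bar>s (m + k) - s m\<bar> \<le> K * real k" for m k
  proof (induction k)
    case (Suc k)
    have "\<bar>s (m + Suc k) - s m\<bar> \<le> K * real k + K" using step[of "m + k"] Suc by simp
    then show ?case by (simp add: distrib_left)
  qed simp
  from LIMSEQ_D[OF lim, of "e/3"] e obtain N where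
    N: "\<And>m. m \<ge> N \<Longrightarrow> \<bar>s (m\<^sup>2) / real (m\<^sup>2)\<bar> < e / 3" by auto
  obtain M where M: "real M > 2 * K / (e / 3)" using reals_Archimedean2 by blast
  define L where "L = Suc (max N M)"
  show "\<exists>no. \<forall>n\<ge>no. norm (s n / real n - 0) < e"
  proof (intro exI[of _ "L\<^sup>2"] allI impI)
    fix n assume n: "L\<^sup>2 \<le> n"
    \<comment> \<open>The integer part of the square root of \<open>n\<close>.\<close>
    define m where "m = (GREATEST m. m\<^sup>2 \<le> n)"
    have bound: "\<forall>y. y\<^sup>2 \<le> n \<longrightarrow> y \<le> n"
      by (metis le_square le_trans power2_eq_square)
    have m1: "m\<^sup>2 \<le> n" unfolding m_def
      by (rule GreatestI_nat[of "\<lambda>m. m\<^sup>2 \<le> n" L n]) (use n bound in auto)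
    have m2: "L \<le> m" unfolding m_def
      by (rule Greatest_le_nat[of "\<lambda>m. m\<^sup>2 \<le> n" L n]) (use n bound in auto)
    have m3: "n < (Suc m)\<^sup>2"
    proof (rule ccontr)
      assume "\<not> n < (Suc m)\<^sup>2"
      then have "Suc m \<le> m" unfolding m_def
        by (intro Greatest_le_nat[of "\<lambda>m. m\<^sup>2 \<le> n" _ n]) (use bound in auto)
      then show False by simp
    qed
    have mpos: "real m > 0" "m \<ge> N" "m \<ge> M" using m2 by (auto simp: L_def)
    have sq: "\<bar>s (m\<^sup>2)\<bar> < e / 3 * real (m\<^sup>2)"
      using N[OF mpos(2)] mpos(1) by (simp add: field_simps)
    have gap: "real (n - m\<^sup>2) \<le> 2 * real m"
    proof -
      have "n - m\<^sup>2 \<le> 2 * m" using m3 by (simp add: power2_eq_square)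
      then show ?thesis by linarith
    qed
    have "2 * K / (e / 3) \<le> real m" using M mpos(3) by linarith
    then have "2 * K \<le> real m * (e / 3)" using e by (subst (asm) pos_divide_le_eq) auto
    then have "2 * K \<le> e / 3 * real m" by (simp only: mult.commute)
    then have lin: "2 * K * real m \<le> e / 3 * real (m\<^sup>2)"
      using mpos(1) by (simp add: power2_eq_square mult_right_mono mult.assoc[symmetric])
    have "\<bar>s n - s (m\<^sup>2)\<bar> \<le> K * real (n - m\<^sup>2)"
      using diff[of "m\<^sup>2" "n - m\<^sup>2"] m1 by simp
    also have "\<dots> \<le> K * (2 * real m)" using gap K by (intro mult_left_mono) auto
    finally have "\<bar>s n\<bar> < e / 3 * real (m\<^sup>2) + e / 3 * real (m\<^sup>2)" using sq lin by linarith
    also have "\<dots> = 2 / 3 * e * real (m\<^sup>2)" by simp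
    also have "\<dots> \<le> 2 / 3 * e * real n" using m1 e by (intro mult_left_mono) (auto simp del: of_nat_power)
    finally have less: "\<bar>s n\<bar> < 2 / 3 * e * real n" .
    have "L\<^sup>2 > 0" by (simp add: L_def)
    then have "real n > 0" using n by linarith
    moreover have "\<bar>s n\<bar> < e * real n" using less mult_pos_pos[OF e \<open>real n > 0\<close>] by linarith
    ultimately show "norm (s n / real n - 0) < e" by (simp add: field_simps)
  qed
qed

text \<open>By monotone convergence the sum of the functions has finite integral, so it is finite almost
  everywhere and its terms vanish.\<close>

lemma AE_tendsto_0_if_summable_integrals:
  fixes f :: "nat \<Rightarrow> 'a \<Rightarrow> real"
  assumes int: "\<And>n. integrable M (f n)" and nn: "\<And>n x. f n x \<ge> 0"
    and sm: "summable (\<lambda>n. \<integral>x. f n x \<partial>M)"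
  shows "AE x in M. (\<lambda>n. f n x) \<longlonglongrightarrow> 0"
proof -
  have [measurable]: "f n \<in> borel_measurable M" for n using int by auto
  have "(\<integral>\<^sup>+x. (\<Sum>n. ennreal (f n x)) \<partial>M) = (\<Sum>n. \<integral>\<^sup>+x. ennreal (f n x) \<partial>M)"
    by (rule nn_integral_suminf) simp
  also have "\<dots> = (\<Sum>n. ennreal (\<integral>x. f n x \<partial>M))"
    by (simp add: nn_integral_eq_integral int nn)
  also have "\<dots> = ennreal (\<Sum>n. \<integral>x. f n x \<partial>M)"
    using sm nn by (intro suminf_ennreal2) auto
  finally have "(\<integral>\<^sup>+x. (\<Sum>n. ennreal (f n x)) \<partial>M) \<noteq> \<infinity>" by simp
  then have "AE x in M. (\<Sum>n. ennreal (f n x)) \<noteq> \<infinity>"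
    by (intro nn_integral_PInf_AE) auto
  then show ?thesis
  proof (eventually_elim)
    case (elim x)
    then have "summable (\<lambda>n. f n x)" using nn by (intro summable_suminf_not_top) auto
    then show ?case by (rule summable_LIMSEQ_zero)
  qed
qed

section \<open>Strong law for bounded martingale differences\<close>

locale discrete_filtration = prob_space M for M :: "'a measure" +
  fixes F :: "nat \<Rightarrow> 'a measure"
  assumes sub: "\<And>n. subalgebra M (F n)"
    and incr: "\<And>n. sets (F n) \<subseteq> sets (F (Suc n))"
begin

lemma subalgebra_sigma_finite: "sigma_finite_subalgebra M (F n)"
proof -
  interpret finite_measure_subalgebra M "F n" by unfold_locales (rule sub)
  show ?thesis by (rule sigma_finite_subalgebra_axioms)
qed

lemma space_F [simp]: "space (F n) = space M"
  using sub[of n] by (simp add: subalgebra_def)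

lemma sets_F_mono: "m \<le> n \<Longrightarrow> sets (F m) \<subseteq> sets (F n)"
  using incr by (rule lift_Suc_mono_le)

lemma subalgebra_F_mono: "m \<le> n \<Longrightarrow> subalgebra (F n) (F m)"
  using sets_F_mono by (simp add: subalgebra_def)

lemma measurable_F_mono: "f \<in> borel_measurable (F m) \<Longrightarrow> m \<le> n \<Longrightarrow> f \<in> borel_measurable (F n)"
  by (rule measurable_from_subalg[OF subalgebra_F_mono])

lemma measurable_F: "f \<in> borel_measurable (F m) \<Longrightarrow> f \<in> borel_measurable M"
  by (rule measurable_from_subalg[OF sub])

text \<open>Each difference is orthogonal to the preceding partial sum, so the second moment of \<open>S\<^sub>n\<close> is
  at most \<open>n K\<^sup>2\<close>. Along \<open>n = m\<^sup>2\<close> the second moments of \<open>S\<^sub>n / n\<close> are then summable, and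
  boundedness of the differences fills the gaps between squares.\<close>

theorem bounded_martingale_difference_slln:
  fixes d :: "nat \<Rightarrow> 'a \<Rightarrow> real"
  assumes adapted: "\<And>n. d n \<in> borel_measurable (F (Suc n))"
    and bounded: "\<And>n. AE x in M. \<bar>d n x\<bar> \<le> K"
    and centred: "\<And>n. AE x in M. real_cond_exp M (F n) (d n) x = 0"
  shows "AE x in M. (\<lambda>n. (\<Sum>j<n. d j x) / real n) \<longlonglongrightarrow> 0"
proof -
  define S where "S n x = (\<Sum>j<n. d j x)" for n x
  have S_adapted: "S n \<in> borel_measurable (F n)" for n
    unfolding S_def by (intro borel_measurable_sum measurable_F_mono[OF adapted]) auto
  have [measurable]: "d n \<in> borel_measurable M" "S n \<in> borel_measurable M" for n
    using measurable_F adapted S_adapted by auto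
  have all_bounded: "AE x in M. \<forall>n. \<bar>d n x\<bar> \<le> K" using bounded by (simp add: AE_all_countable)
  have S_bounded: "AE x in M. \<bar>S n x\<bar> \<le> real n * K" for n
    using all_bounded
  proof eventually_elim
    case (elim x)
    have "\<bar>S n x\<bar> \<le> (\<Sum>j<n. \<bar>d j x\<bar>)" unfolding S_def by simp
    also have "\<dots> \<le> (\<Sum>j<n. K)" using elim by (intro sum_mono) auto
    finally show ?case by simp
  qed
  have K: "K \<ge> 0"
  proof (rule ccontr)
    assume "\<not> K \<ge> 0"
    have "AE x in M. False"
      using bounded[of 0] by (rule eventually_mono) (use \<open>\<not> K \<ge> 0\<close> in auto)
    then show False by simp
  qed
  have int_d2: "integrable M (\<lambda>x. (d n x)\<^sup>2)" for n
    by (rule integrable_const_bound[where B="K\<^sup>2"])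
       (use bounded[of n] in \<open>auto elim!: eventually_mono simp: abs_le_square_iff[symmetric]\<close>)
  have int_S2: "integrable M (\<lambda>x. (S n x)\<^sup>2)" for n
    by (rule integrable_const_bound[where B="(real n * K)\<^sup>2"])
       (use S_bounded[of n] K in \<open>auto elim!: eventually_mono simp: abs_le_square_iff[symmetric]\<close>)
  have int_Sd: "integrable M (\<lambda>x. S n x * d n x)" for n
  proof (rule integrable_const_bound[where B="real n * K * K"])
    show "AE x in M. norm (S n x * d n x) \<le> real n * K * K"
      using S_bounded[of n] bounded[of n]
      by eventually_elim (auto simp: abs_mult K intro!: mult_mono)
  qed simp
  have orth: "(\<integral>x. S n x * d n x \<partial>M) = 0" for n
  proof -
    interpret c: sigma_finite_subalgebra M "F n" by (rule subalgebra_sigma_finite)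
    have "(\<integral>x. S n x * d n x \<partial>M) = (\<integral>x. S n x * real_cond_exp M (F n) (d n) x \<partial>M)"
      using c.real_cond_exp_intg(2)[OF int_Sd S_adapted] by simp
    also have "\<dots> = (\<integral>x. 0 \<partial>M)"
      using centred[of n] measurable_F[OF borel_measurable_cond_exp]
      by (intro integral_cong_AE) auto
    finally show ?thesis by simp
  qed
  have var: "(\<integral>x. (S n x)\<^sup>2 \<partial>M) \<le> real n * K\<^sup>2" for n
  proof (induction n)
    case 0 show ?case by (simp add: S_def)
  next
    case (Suc n)
    have "(\<integral>x. (S (Suc n) x)\<^sup>2 \<partial>M) = (\<integral>x. (S n x)\<^sup>2 + 2 * (S n x * d n x) + (d n x)\<^sup>2 \<partial>M)"
      by (intro Bochner_Integration.integral_cong) (auto simp: S_def power2_eq_square algebra_simps)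
    also have "\<dots> = (\<integral>x. (S n x)\<^sup>2 \<partial>M) + (\<integral>x. (d n x)\<^sup>2 \<partial>M)"
      by (simp add: int_S2 int_Sd int_d2 orth)
    also have "(\<integral>x. (d n x)\<^sup>2 \<partial>M) \<le> (\<integral>x. K\<^sup>2 \<partial>M)"
      by (intro integral_mono_AE int_d2)
         (use bounded[of n] in \<open>auto elim!: eventually_mono simp: abs_le_square_iff[symmetric]\<close>)
    finally show ?case using Suc by (simp add: prob_space algebra_simps)
  qed
  have "AE x in M. (\<lambda>n. (S (n\<^sup>2) x / real (n\<^sup>2))\<^sup>2) \<longlonglongrightarrow> 0"
  proof (rule AE_tendsto_0_if_summable_integrals)
    show "integrable M (\<lambda>x. (S (n\<^sup>2) x / real (n\<^sup>2))\<^sup>2)" for n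
      using int_S2[of "n\<^sup>2"] by (simp add: power_divide del: of_nat_power)
    show "summable (\<lambda>n. \<integral>x. (S (n\<^sup>2) x / real (n\<^sup>2))\<^sup>2 \<partial>M)"
    proof (rule summable_comparison_test'[of "\<lambda>n. K\<^sup>2 * (1 / real n ^ 2)" 1])
      show "summable (\<lambda>n. K\<^sup>2 * (1 / real n ^ 2))"
        using inverse_power_summable[of 2, where 'a=real] by (intro summable_mult) (simp add: inverse_eq_divide)
      fix n :: nat assume n: "n \<ge> 1"
      have "(\<integral>x. (S (n\<^sup>2) x / real (n\<^sup>2))\<^sup>2 \<partial>M) = (\<integral>x. (S (n\<^sup>2) x)\<^sup>2 \<partial>M) / (real (n\<^sup>2))\<^sup>2"
        by (simp add: power_divide del: of_nat_power)
      also have "\<dots> \<le> real (n\<^sup>2) * K\<^sup>2 / (real (n\<^sup>2))\<^sup>2" by (intro divide_right_mono var) auto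
      also have "\<dots> = K\<^sup>2 * (1 / real n ^ 2)" using n by (simp add: power2_eq_square)
      finally have "(\<integral>x. (S (n\<^sup>2) x / real (n\<^sup>2))\<^sup>2 \<partial>M) \<le> K\<^sup>2 * (1 / real n ^ 2)" .
      then show "norm (\<integral>x. (S (n\<^sup>2) x / real (n\<^sup>2))\<^sup>2 \<partial>M) \<le> K\<^sup>2 * (1 / real n ^ 2)"
        by simp
    qed
  qed simp
  then show ?thesis using all_bounded
  proof eventually_elim
    case (elim x)
    have "(\<lambda>n. S n x / real n) \<longlonglongrightarrow> 0"
    proof (rule square_subsequence_interpolation)
      show "\<bar>S (Suc n) x - S n x\<bar> \<le> K" for n using elim by (simp add: S_def)
      show "(\<lambda>n. S (n\<^sup>2) x / real (n\<^sup>2)) \<longlonglongrightarrow> 0"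
      proof (rule tendsto_rabs_zero_cancel)
        show "(\<lambda>n. \<bar>S (n\<^sup>2) x / real (n\<^sup>2)\<bar>) \<longlonglongrightarrow> 0"
          using tendsto_real_sqrt[OF elim(1)] by (simp add: real_sqrt_abs del: of_nat_power)
      qed
    qed
    then show ?case by (simp add: S_def)
  qed
qed

section \<open>Levy's upward theorem\<close>

text \<open>The first index at which the conditional expectation exceeds \<open>a\<close> splits the event into disjoint
  pieces, the \<open>k\<close>-th of which lies in \<open>F k\<close>. On that piece the integral of \<open>V\<close> equals that of its
  conditional expectation, hence is at least \<open>a\<close> times the measure.\<close>

lemma doob_maximal_inequality:
  assumes V: "integrable M V" and nn: "\<And>x. V x \<ge> 0" and a: "a > 0"
  shows "measure M {x\<in>space M. \<exists>k. real_cond_exp M (F k) V x > a} \<le> (\<integral>x. V x \<partial>M) / a"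
proof -
  define E where "E k = real_cond_exp M (F k) V" for k
  have E_F: "E k \<in> borel_measurable (F k)" for k unfolding E_def by simp
  have [measurable]: "E k \<in> borel_measurable M" for k using measurable_F E_F by auto
  define B where "B k = {x\<in>space M. E k x > a \<and> (\<forall>j<k. \<not> E j x > a)}" for k
  have B_F: "B k \<in> sets (F k)" for k
  proof -
    have [measurable]: "j \<le> k \<Longrightarrow> E j \<in> borel_measurable (F k)" for j
      using measurable_F_mono E_F by auto
    have "B k = {x\<in>space (F k). E k x > a \<and> (\<forall>j\<in>{..<k}. \<not> E j x > a)}"
      by (auto simp: B_def)
    also have "\<dots> \<in> sets (F k)"
      by (intro sets.sets_Collect sets.sets_Collect_finite_All) (use \<open>\<And>j. j \<le> k \<Longrightarrow> E j \<in> borel_measurable (F k)\<close>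
          borel_measurable_less[of "\<lambda>_. a" "F k"] in auto)
    finally show ?thesis .
  qed
  have B_M [measurable]: "B k \<in> sets M" for k using B_F sub[of k] by (auto simp: subalgebra_def)
  have B_disj: "i \<noteq> j \<Longrightarrow> B i \<inter> B j = {}" for i j
    by (auto simp: B_def elim: linorder_neqE_nat)
  have B_UN: "{x\<in>space M. \<exists>k. E k x > a} = (\<Union>k. B k)"
  proof (intro set_eqI iffI)
    fix x assume x: "x \<in> {x\<in>space M. \<exists>k. E k x > a}"
    then have "E (LEAST k. E k x > a) x > a" by (auto intro: LeastI)
    then have "x \<in> B (LEAST k. E k x > a)" using x by (auto simp: B_def dest: not_less_Least)
    then show "x \<in> (\<Union>k. B k)" by auto
  qed (auto simp: B_def)
  have VB: "set_integrable M A V" if "A \<in> sets M" for A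
    unfolding set_integrable_def using integrable_mult_indicator[OF that V] by simp
  have aB: "a * measure M (B k) \<le> (LINT x:B k|M. V x)" for k
  proof -
    interpret c: sigma_finite_subalgebra M "F k" by (rule subalgebra_sigma_finite)
    have "a * measure M (B k) = (LINT x:B k|M. a)" by (simp add: set_lebesgue_integral_def)
    also have "\<dots> \<le> (LINT x:B k|M. E k x)"
      unfolding set_lebesgue_integral_def
    proof (rule integral_mono)
      show "integrable M (\<lambda>x. indicat_real (B k) x *\<^sub>R a)"
        by (simp add: emeasure_eq_measure)
      show "integrable M (\<lambda>x. indicat_real (B k) x *\<^sub>R E k x)"
        unfolding E_def by (rule integrable_mult_indicator[OF B_M c.real_cond_exp_int(1)[OF V]])
      show "indicat_real (B k) x *\<^sub>R a \<le> indicat_real (B k) x *\<^sub>R E k x" for x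
        by (auto simp: B_def indicator_def)
    qed
    also have "\<dots> = (LINT x:B k|M. V x)" unfolding E_def
      by (rule c.real_cond_exp_intA[OF V B_F, symmetric])
    finally show ?thesis .
  qed
  have sm: "(\<lambda>k. measure M (B k)) sums measure M (\<Union>k. B k)"
    using B_disj by (intro finite_measure_UNION) (auto simp: disjoint_family_on_def)
  have "a * measure M (\<Union>k. B k) = (\<Sum>k. a * measure M (B k))"
    using sums_mult[OF sm] sums_unique by blast
  also have "\<dots> \<le> (\<integral>x. V x \<partial>M)"
  proof (rule suminf_le_const)
    show "summable (\<lambda>k. a * measure M (B k))" using sums_mult[OF sm] sums_summable by blast
    fix n
    have "(\<Sum>k<n. a * measure M (B k)) \<le> (\<Sum>k<n. (LINT x:B k|M. V x))" by (intro sum_mono aB)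
    also have "\<dots> = (LINT x:(\<Union>k<n. B k)|M. V x)"
      by (rule set_integral_finite_Union[symmetric]) (auto simp: disjoint_family_on_def B_disj VB)
    also have "\<dots> \<le> (\<integral>x. V x \<partial>M)" unfolding set_lebesgue_integral_def
      using VB[of "\<Union>k<n. B k"] V nn
      by (intro integral_mono) (auto simp: set_integrable_def indicator_def)
    finally show "(\<Sum>k<n. a * measure M (B k)) \<le> (\<integral>x. V x \<partial>M)" .
  qed
  finally show ?thesis using a by (simp add: B_UN[unfolded E_def] field_simps)
qed

lemma maximal_inequality_abs:
  assumes W: "integrable M W" and a: "a > 0"
  shows "measure M {x\<in>space M. \<exists>k. \<bar>real_cond_exp M (F k) W x\<bar> > a} \<le> (\<integral>x. \<bar>W x\<bar> \<partial>M) / a"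
proof -
  have [measurable]: "real_cond_exp M (F k) g \<in> borel_measurable M" for k g
    by (rule measurable_F[OF borel_measurable_cond_exp])
  have "AE x in M. \<bar>real_cond_exp M (F k) W x\<bar> \<le> real_cond_exp M (F k) (\<lambda>x. \<bar>W x\<bar>) x" for k
  proof -
    interpret c: sigma_finite_subalgebra M "F k" by (rule subalgebra_sigma_finite)
    have W': "integrable M (\<lambda>x. \<bar>W x\<bar>)" "integrable M (\<lambda>x. - \<bar>W x\<bar>)" using W by auto
    have "AE x in M. real_cond_exp M (F k) W x \<le> real_cond_exp M (F k) (\<lambda>x. \<bar>W x\<bar>) x"
      by (intro c.real_cond_exp_mono W W') auto
    moreover have "AE x in M. real_cond_exp M (F k) (\<lambda>x. - \<bar>W x\<bar>) x \<le> real_cond_exp M (F k) W x"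
      by (intro c.real_cond_exp_mono W W') auto
    moreover have "AE x in M. real_cond_exp M (F k) (\<lambda>x. (-1) * \<bar>W x\<bar>) x
        = (-1) * real_cond_exp M (F k) (\<lambda>x. \<bar>W x\<bar>) x"
      by (intro c.real_cond_exp_cmult W')
    ultimately show ?thesis by eventually_elim auto
  qed
  then have *: "AE x in M. \<forall>k. \<bar>real_cond_exp M (F k) W x\<bar> \<le> real_cond_exp M (F k) (\<lambda>x. \<bar>W x\<bar>) x"
    by (simp add: AE_all_countable)
  have "measure M {x\<in>space M. \<exists>k. \<bar>real_cond_exp M (F k) W x\<bar> > a}
      \<le> measure M {x\<in>space M. \<exists>k. real_cond_exp M (F k) (\<lambda>x. \<bar>W x\<bar>) x > a}"
    by (rule finite_measure_mono_AE)
       (use * in \<open>auto elim!: eventually_mono intro: less_le_trans\<close>)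
  also have "\<dots> \<le> (\<integral>x. \<bar>W x\<bar> \<partial>M) / a" using W a by (intro doob_maximal_inequality) auto
  finally show ?thesis .
qed

text \<open>The functions that the martingale of their own conditional expectations recovers. Levy's theorem
  says that every integrable function measurable in the limit belongs to this class.\<close>

definition levy_class :: "('a \<Rightarrow> real) set" where
  "levy_class = {Y. integrable M Y \<and> (AE x in M. (\<lambda>k. real_cond_exp M (F k) Y x) \<longlonglongrightarrow> Y x)}"

text \<open>If \<open>Z\<close> is in the class, then the upper limit of \<open>\<bar>E(Y | F k) - Y\<bar>\<close> is at most
  \<open>sup\<^sub>k \<bar>E(Y - Z | F k)\<bar> + \<bar>Y - Z\<bar>\<close>. Both terms are small in probability when \<open>Y - Z\<close> is small in
  mean, the first one by the maximal inequality.\<close>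

lemma levy_class_closed:
  assumes Y: "integrable M Y"
    and approx: "\<And>e. e > 0 \<Longrightarrow> \<exists>Z\<in>levy_class. (\<integral>x. \<bar>Y x - Z x\<bar> \<partial>M) \<le> e"
  shows "Y \<in> levy_class"
proof -
  have [measurable]: "real_cond_exp M (F k) g \<in> borel_measurable M" for k g
    by (rule measurable_F[OF borel_measurable_cond_exp])
  have [measurable]: "Y \<in> borel_measurable M" using Y by auto
  define bad where "bad a = {x\<in>space M. \<not> (\<exists>N. \<forall>k\<ge>N. \<bar>real_cond_exp M (F k) Y x - Y x\<bar> \<le> 3 * a)}" for a
  have bad [measurable]: "bad a \<in> sets M" for a unfolding bad_def by measurable
  \<comment> \<open>Approximating \<open>Y\<close> within \<open>e * a / 2\<close> bounds the measure of each of the two exceptional sets by \<open>e / 2\<close>.\<close>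
  have small: "measure M (bad a) \<le> e" if a: "a > 0" and e: "e > 0" for a e
  proof -
    have "e * a / 2 > 0" using a e by simp
    from approx[OF this] obtain Z where Z: "Z \<in> levy_class"
      and YZ: "(\<integral>x. \<bar>Y x - Z x\<bar> \<partial>M) \<le> e * a / 2" by blast
    have iZ: "integrable M Z" and lZ: "AE x in M. (\<lambda>k. real_cond_exp M (F k) Z x) \<longlonglongrightarrow> Z x"
      using Z by (auto simp: levy_class_def)
    have [measurable]: "Z \<in> borel_measurable M" using iZ by auto
    define W where "W x = Y x - Z x" for x
    have iW: "integrable M W" unfolding W_def using Y iZ by simp
    have [measurable]: "W \<in> borel_measurable M" using iW by auto
    have lin: "AE x in M. \<forall>k. real_cond_exp M (F k) W x = real_cond_exp M (F k) Y x - real_cond_exp M (F k) Z x"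
      unfolding W_def AE_all_countable
      by (intro allI sigma_finite_subalgebra.real_cond_exp_diff[OF subalgebra_sigma_finite] Y iZ)
    let ?A = "{x\<in>space M. \<exists>k. \<bar>real_cond_exp M (F k) W x\<bar> > a}"
    let ?B = "{x\<in>space M. \<bar>W x\<bar> \<ge> a}"
    have "measure M (bad a) \<le> measure M (?A \<union> ?B)"
    proof (rule finite_measure_mono_AE)
      show "AE x in M. x \<in> bad a \<longrightarrow> x \<in> ?A \<union> ?B" using lin lZ AE_space
      proof eventually_elim
        case (elim x)
        show ?case
        proof (rule impI, rule ccontr)
          assume b: "x \<in> bad a" and n: "x \<notin> ?A \<union> ?B"
          have W: "\<bar>real_cond_exp M (F k) W x\<bar> \<le> a" "\<bar>W x\<bar> < a" for k
            using n elim(3) by (auto simp: not_less not_le)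
          obtain N where N: "\<And>k. k \<ge> N \<Longrightarrow> \<bar>real_cond_exp M (F k) Z x - Z x\<bar> < a"
            using LIMSEQ_D[OF elim(2) a] by auto
          have "\<bar>real_cond_exp M (F k) Y x - Y x\<bar> \<le> 3 * a" if "k \<ge> N" for k
            using N[OF that] W(1)[of k] W(2) elim(1)[rule_format, of k] unfolding W_def by linarith
          with b show False by (auto simp: bad_def)
        qed
      qed
    qed simp
    also have "\<dots> \<le> measure M ?A + measure M ?B" by (rule measure_Un_le) auto
    also have "measure M ?A \<le> (\<integral>x. \<bar>W x\<bar> \<partial>M) / a" by (rule maximal_inequality_abs[OF iW a])
    also have "measure M ?B \<le> (\<integral>x. \<bar>W x\<bar> \<partial>M) / a"
      using integral_Markov_inequality_measure[of M "\<lambda>x. \<bar>W x\<bar>" "{}" a] iW a by simp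
    finally have "measure M (bad a) \<le> 2 * ((\<integral>x. \<bar>W x\<bar> \<partial>M) / a)" by simp
    also have "\<dots> \<le> 2 * ((e * a / 2) / a)"
      using YZ a unfolding W_def by (intro mult_left_mono divide_right_mono) auto
    finally show ?thesis using a by simp
  qed
  have "AE x in M. x \<notin> bad a" if "a > 0" for a
  proof -
    have "measure M (bad a) = 0"
      using small[OF that] measure_nonneg[of M "bad a"] by (metis dense not_le order.antisym)
    then show ?thesis by (intro AE_not_in) (auto simp: null_sets_def emeasure_eq_measure)
  qed
  then have "AE x in M. \<forall>n. x \<notin> bad (1 / real (Suc n))" by (simp add: AE_all_countable)
  then have "AE x in M. (\<lambda>k. real_cond_exp M (F k) Y x) \<longlonglongrightarrow> Y x" using AE_space
  proof eventually_elim
    case (elim x)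
    show ?case
    proof (rule LIMSEQ_I)
      fix r :: real assume "r > 0"
      then obtain n where n: "1 / real (Suc n) < r / 3" using nat_approx_posE[of "r/3"] by auto
      from elim obtain N where N: "\<And>k. k \<ge> N \<Longrightarrow> \<bar>real_cond_exp M (F k) Y x - Y x\<bar> \<le> 3 * (1 / real (Suc n))"
        unfolding bad_def by blast
      show "\<exists>no. \<forall>k\<ge>no. norm (real_cond_exp M (F k) Y x - Y x) < r"
        using N n by (intro exI[of _ N]) (auto simp del: of_nat_Suc intro: le_less_trans)
    qed
  qed
  with Y show ?thesis by (simp add: levy_class_def)
qed

lemma levy_class_lincomb:
  assumes "Y \<in> levy_class" "Z \<in> levy_class"
  shows "(\<lambda>x. a * Y x + b * Z x) \<in> levy_class"
proof -
  have i: "integrable M Y" "integrable M Z" using assms by (auto simp: levy_class_def)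
  have 1: "AE x in M. \<forall>k. real_cond_exp M (F k) (\<lambda>x. a * Y x + b * Z x) x =
     real_cond_exp M (F k) (\<lambda>x. a * Y x) x + real_cond_exp M (F k) (\<lambda>x. b * Z x) x"
    unfolding AE_all_countable
    by (intro allI sigma_finite_subalgebra.real_cond_exp_add[OF subalgebra_sigma_finite]) (use i in auto)
  have 2: "AE x in M. \<forall>k. real_cond_exp M (F k) (\<lambda>x. c * W x) x = c * real_cond_exp M (F k) W x"
    if "integrable M W" for c W
    unfolding AE_all_countable
    by (intro allI sigma_finite_subalgebra.real_cond_exp_cmult[OF subalgebra_sigma_finite] that)
  have "AE x in M. (\<lambda>k. real_cond_exp M (F k) Y x) \<longlonglongrightarrow> Y x"
       "AE x in M. (\<lambda>k. real_cond_exp M (F k) Z x) \<longlonglongrightarrow> Z x"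
    using assms by (auto simp: levy_class_def)
  then have "AE x in M. (\<lambda>k. real_cond_exp M (F k) (\<lambda>x. a * Y x + b * Z x) x) \<longlonglongrightarrow> a * Y x + b * Z x"
    using 1 2[OF i(1), of a] 2[OF i(2), of b]
    by eventually_elim (auto intro!: tendsto_intros)
  then show ?thesis using i by (simp add: levy_class_def)
qed

definition F_inf :: "'a measure" where
  "F_inf = sigma (space M) (\<Union>n. sets (F n))"

lemma space_F_inf [simp]: "space F_inf = space M"
  unfolding F_inf_def by (intro space_measure_of) (use sets.space_closed space_F in blast)

lemma sets_F_inf: "sets F_inf = sigma_sets (space M) (\<Union>n. sets (F n))"
  unfolding F_inf_def by (intro sets_measure_of) (use sets.space_closed space_F in blast)

lemma F_le_F_inf: "subalgebra F_inf (F n)"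
  by (auto simp: subalgebra_def sets_F_inf)

lemma F_inf_le: assumes "\<And>n. sets (F n) \<subseteq> sets N" "space N = space M" shows "subalgebra N F_inf"
  unfolding subalgebra_def sets_F_inf space_F_inf
  using sets.sigma_sets_subset[of "\<Union>n. sets (F n)" N] assms by auto

lemma subalgebra_F_inf: "subalgebra M F_inf"
  using sub by (intro F_inf_le) (auto simp: subalgebra_def)

text \<open>An event of some \<open>F m\<close> is recovered exactly from index \<open>m\<close> on. Such events form a family
  closed under intersection, and the closure lemma provides the countable disjoint unions needed for
  Dynkin's theorem.\<close>

lemma indicator_in_levy_class:
  assumes "A \<in> sets F_inf"
  shows "indicat_real A \<in> levy_class"
proof -
  have M: "B \<in> sets M" if "B \<in> sets F_inf" for B
    using that subalgebra_F_inf by (auto simp: subalgebra_def)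
  have base: "indicat_real B \<in> levy_class" if B: "B \<in> sets (F m)" for m B
  proof -
    have i: "integrable M (indicat_real B)"
      using B sub[of m] by (intro integrable_real_indicator) (auto simp: subalgebra_def emeasure_eq_measure)
    have "AE x in M. \<forall>k. k \<ge> m \<longrightarrow> real_cond_exp M (F k) (indicat_real B) x = indicat_real B x"
      unfolding AE_all_countable
    proof (intro allI)
      fix k
      show "AE x in M. k \<ge> m \<longrightarrow> real_cond_exp M (F k) (indicat_real B) x = indicat_real B x"
      proof (cases "k \<ge> m")
        case True
        then have "B \<in> sets (F k)" using B sets_F_mono by blast
        then show ?thesis
          using sigma_finite_subalgebra.real_cond_exp_F_meas[OF subalgebra_sigma_finite i, of k] by auto
      qed simp
    qed
    then have "AE x in M. (\<lambda>k. real_cond_exp M (F k) (indicat_real B) x) \<longlonglongrightarrow> indicat_real B x"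
      by eventually_elim (auto intro!: tendsto_eventually eventually_sequentiallyI[of m])
    with i show ?thesis by (simp add: levy_class_def)
  qed
  have "Int_stable (\<Union>n. sets (F n))"
  proof (rule Int_stableI)
    fix a b assume "a \<in> (\<Union>n. sets (F n))" "b \<in> (\<Union>n. sets (F n))"
    then obtain m n where "a \<in> sets (F m)" "b \<in> sets (F n)" by auto
    then have "a \<in> sets (F (max m n))" "b \<in> sets (F (max m n))"
      using sets_F_mono[of m "max m n"] sets_F_mono[of n "max m n"] by auto
    then show "a \<inter> b \<in> (\<Union>n. sets (F n))" by blast
  qed
  moreover have "(\<Union>n. sets (F n)) \<subseteq> Pow (space M)" using sets.space_closed space_F by blast
  ultimately show ?thesis using assms[unfolded sets_F_inf]
  proof (induction rule: sigma_sets_induct_disjoint)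
    case (basic A) then show ?case using base by auto
  next
    case empty show ?case by (rule base[of "{}" 0]) simp
  next
    case (compl A)
    have "(\<lambda>x. 1 * indicat_real (space M) x + (-1) * indicat_real A x) \<in> levy_class"
      using compl base[of "space M" 0] sets.top[of "F 0"] by (intro levy_class_lincomb) auto
    moreover have "A \<subseteq> space M" using sets.sets_into_space[of A F_inf] compl by (simp add: sets_F_inf)
    then have "(\<lambda>x. 1 * indicat_real (space M) x + (-1) * indicat_real A x) = indicat_real (space M - A)"
      by (intro ext) (auto simp: indicator_def)
    ultimately show ?case by simp
  next
    case (union A)
    then have A: "A i \<in> sets M" for i using M[of "A i"] by (auto simp: sets_F_inf)
    have disj: "disjoint_family A" using union by blast
    have fin: "indicat_real (\<Union>i<n. A i) \<in> levy_class" for n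
    proof (induction n)
      case 0 show ?case by (rule base[of _ 0]) simp
    next
      case (Suc n)
      have "(\<lambda>x. 1 * indicat_real (\<Union>i<n. A i) x + 1 * indicat_real (A n) x) \<in> levy_class"
        using Suc union by (intro levy_class_lincomb) auto
      moreover have "A n \<inter> (\<Union>i<n. A i) = {}"
        using disj by (auto simp: disjoint_family_on_def) (metis IntI emptyE less_irrefl)
      then have "(\<lambda>x. 1 * indicat_real (\<Union>i<n. A i) x + 1 * indicat_real (A n) x) = indicat_real (\<Union>i<Suc n. A i)"
        by (intro ext) (auto simp: indicator_def lessThan_Suc)
      ultimately show ?case by simp
    qed
    show ?case
    proof (rule levy_class_closed)
      show "integrable M (indicat_real (\<Union> (range A)))"
        using A by (intro integrable_real_indicator) (auto simp: emeasure_eq_measure)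
      fix e :: real assume e: "e > 0"
      have "(\<lambda>n. measure M (\<Union>i<n. A i)) \<longlonglongrightarrow> measure M (\<Union>n. \<Union>i<n. A i)"
        using A by (intro finite_Lim_measure_incseq) (auto simp: incseq_def intro: less_le_trans)
      moreover have "(\<Union>n. \<Union>i<n. A i) = (\<Union>i. A i)" by blast
      ultimately obtain n where n: "\<bar>measure M (\<Union>i<n. A i) - measure M (\<Union>i. A i)\<bar> < e"
        using LIMSEQ_D[OF _ e] by fastforce
      have "(\<integral>x. \<bar>indicat_real (\<Union> (range A)) x - indicat_real (\<Union>i<n. A i) x\<bar> \<partial>M)
          = (\<integral>x. indicat_real (\<Union> (range A)) x - indicat_real (\<Union>i<n. A i) x \<partial>M)"
        by (intro Bochner_Integration.integral_cong) (auto simp: indicator_def)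
      also have "\<dots> = measure M (\<Union>i. A i) - measure M (\<Union>i<n. A i)"
        using A sets.sets_into_space[OF A]
        by (subst Bochner_Integration.integral_diff) (auto simp: emeasure_eq_measure)
      also have "\<dots> \<le> e" using n by simp
      finally show "\<exists>Z\<in>levy_class. (\<integral>x. \<bar>indicat_real (\<Union> (range A)) x - Z x\<bar> \<partial>M) \<le> e"
        using fin by blast
    qed
  qed
qed

lemma F_inf_measurable_in_levy_class:
  assumes "integrable M Y" "Y \<in> borel_measurable F_inf"
  shows "Y \<in> levy_class"
proof -
  let ?N = "restr_to_subalg M F_inf"
  have down: "integrable M g" if "integrable ?N g" for g :: "'a \<Rightarrow> real"
    using integrable_from_subalg[OF subalgebra_F_inf that] .
  have "integrable ?N Y" by (rule integrable_in_subalg[OF subalgebra_F_inf assms(2,1)])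
  then show ?thesis
  proof (induction rule: integrable_induct)
    case (base A c)
    then have "A \<in> sets F_inf" by (simp add: sets_restr_to_subalg[OF subalgebra_F_inf])
    then have "(\<lambda>x. c * indicat_real A x + 0 * indicat_real A x) \<in> levy_class"
      by (intro levy_class_lincomb indicator_in_levy_class)
    then show ?case by (simp add: mult.commute)
  next
    case (add f g)
    then have "(\<lambda>x. 1 * f x + 1 * g x) \<in> levy_class" by (intro levy_class_lincomb)
    then show ?case by simp
  next
    case (lim f s)
    have f: "integrable M f" using lim down by auto
    have s: "integrable M (s i)" for i using lim down by auto
    show ?case
    proof (rule levy_class_closed[OF f])
      fix e :: real assume e: "e > 0"
      have "(\<lambda>i. \<integral>x. \<bar>f x - s i x\<bar> \<partial>M) \<longlonglongrightarrow> (\<integral>x. 0 \<partial>M)"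
      proof (rule integral_dominated_convergence[where w = "\<lambda>x. 3 * \<bar>f x\<bar>"])
        show "AE x in M. (\<lambda>i. \<bar>f x - s i x\<bar>) \<longlonglongrightarrow> 0"
        proof (rule AE_I2)
          fix x assume "x \<in> space M"
          then have "(\<lambda>i. s i x) \<longlonglongrightarrow> f x" using lim(2) by (simp add: space_restr_to_subalg)
          then have "(\<lambda>i. \<bar>f x - s i x\<bar>) \<longlonglongrightarrow> \<bar>f x - f x\<bar>" by (intro tendsto_intros)
          then show "(\<lambda>i. \<bar>f x - s i x\<bar>) \<longlonglongrightarrow> 0" by simp
        qed
        show "AE x in M. norm \<bar>f x - s i x\<bar> \<le> 3 * \<bar>f x\<bar>" for i
        proof (rule AE_I2)
          fix x assume "x \<in> space M"
          then have "\<bar>s i x\<bar> \<le> 2 * \<bar>f x\<bar>" using lim(3)[of x i] by (simp add: space_restr_to_subalg)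
          then show "norm \<bar>f x - s i x\<bar> \<le> 3 * \<bar>f x\<bar>" by simp
        qed
      qed (use f s in auto)
      from LIMSEQ_D[OF this e] obtain i where "(\<integral>x. \<bar>f x - s i x\<bar> \<partial>M) < e" by fastforce
      then show "\<exists>Z\<in>levy_class. (\<integral>x. \<bar>f x - Z x\<bar> \<partial>M) \<le> e"
        using lim.IH[of i] by (intro bexI[of _ "s i"]) auto
    qed
  qed
qed

text \<open>Apply the class to \<open>E(f | F\<^sub>\<infinity>)\<close> and remove the inner conditioning by the tower property.\<close>

theorem levy_upward:
  assumes f: "integrable M f"
  shows "AE x in M. (\<lambda>k. real_cond_exp M (F k) f x) \<longlonglongrightarrow> real_cond_exp M F_inf f x"
proof -
  interpret i: finite_measure_subalgebra M F_inf by unfold_locales (rule subalgebra_F_inf)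
  have "real_cond_exp M F_inf f \<in> levy_class"
    by (intro F_inf_measurable_in_levy_class i.real_cond_exp_int(1) f borel_measurable_cond_exp)
  then have *: "AE x in M. (\<lambda>k. real_cond_exp M (F k) (real_cond_exp M F_inf f) x) \<longlonglongrightarrow> real_cond_exp M F_inf f x"
    by (simp add: levy_class_def)
  have "AE x in M. \<forall>k. real_cond_exp M (F k) (real_cond_exp M F_inf f) x = real_cond_exp M (F k) f x"
    unfolding AE_all_countable
    by (intro allI sigma_finite_subalgebra.real_cond_exp_nested_subalg[OF subalgebra_sigma_finite] subalgebra_F_inf F_le_F_inf f)
  with * show ?thesis by eventually_elim simp
qed

end

section \<open>Refining partitions of the line\<close>

lemma quantizer_eq:
  assumes "partition_on UNIV Q" "A \<in> Q" "x \<in> A"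
  shows "quantizer Q x = A"
  unfolding quantizer_def
  using assms by (intro the_equality) (auto simp: partition_on_def disjoint_def)

lemma quantizer_mem:
  assumes "partition_on UNIV Q"
  shows "quantizer Q x \<in> Q" "x \<in> quantizer Q x"
proof -
  obtain A where "A \<in> Q" "x \<in> A" using assms by (auto simp: partition_on_def)
  with quantizer_eq[OF assms] show "quantizer Q x \<in> Q" "x \<in> quantizer Q x" by auto
qed

text \<open>The sets that do not separate \<open>x\<close> from \<open>y\<close> form a \<open>\<sigma>\<close>-algebra.\<close>

lemma sigma_sets_indistinguishable:
  assumes "A \<in> sigma_sets UNIV \<G>" and "\<And>G. G \<in> \<G> \<Longrightarrow> x \<in> G \<longleftrightarrow> y \<in> G"
  shows "x \<in> A \<longleftrightarrow> y \<in> A"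
  using assms(1) by induction (auto simp: assms(2))

lemma quantizer_refine:
  assumes "partition_on UNIV Q" "partition_on UNIV Q'" "sigma_sets UNIV Q \<subseteq> sigma_sets UNIV Q'"
    and "quantizer Q' x = quantizer Q' y"
  shows "quantizer Q x = quantizer Q y"
proof -
  have "quantizer Q x \<in> sigma_sets UNIV Q'"
    using assms(3) quantizer_mem(1)[OF assms(1)] by blast
  moreover have "x \<in> G \<longleftrightarrow> y \<in> G" if "G \<in> Q'" for G
    using assms(2,4) that quantizer_mem quantizer_eq by metis
  ultimately have "y \<in> quantizer Q x"
    using sigma_sets_indistinguishable quantizer_mem(2)[OF assms(1)] by metis
  then show ?thesis using quantizer_eq[OF assms(1) quantizer_mem(1)[OF assms(1)]] by metis
qed

text \<open>Cells are numbered so that quantized paths take values in a countable type.\<close>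

definition cell_index :: "real set set \<Rightarrow> real \<Rightarrow> nat" where
  "cell_index Q x = to_nat_on Q (quantizer Q x)"

lemma cell_index_eq_iff:
  assumes "partition_on UNIV Q" "finite Q"
  shows "cell_index Q x = cell_index Q y \<longleftrightarrow> quantizer Q x = quantizer Q y"
  unfolding cell_index_def
  using assms quantizer_mem(1)[OF assms(1)]
  by (intro inj_on_eq_iff[OF inj_on_to_nat_on]) (auto simp: countable_finite)

lemma borel_right_semiclosed: "right_semiclosed A \<Longrightarrow> A \<in> sets borel"
  by (auto simp: right_semiclosed_def)

lemma right_semiclosed_between:
  "right_semiclosed A \<Longrightarrow> x \<in> A \<Longrightarrow> y \<in> A \<Longrightarrow> x \<le> z \<Longrightarrow> z \<le> y \<Longrightarrow> z \<in> A"
  by (auto simp: right_semiclosed_def)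

lemma measurable_cell_index:
  assumes "partition_on UNIV Q" "finite Q" "\<And>A. A \<in> Q \<Longrightarrow> A \<in> sets borel"
  shows "cell_index Q \<in> borel \<rightarrow>\<^sub>M count_space UNIV"
  unfolding measurable_count_space_eq2_countable
proof (intro conjI ballI)
  fix n
  have "cell_index Q -` {n} \<inter> space borel = \<Union>{A\<in>Q. to_nat_on Q A = n}"
    using quantizer_mem[OF assms(1)] quantizer_eq[OF assms(1)]
    by (auto simp: cell_index_def) blast
  then show "cell_index Q -` {n} \<inter> space borel \<in> sets borel"
    using assms by (auto intro!: sets.finite_Union)
qed auto

lemma borel_measurable_if_constant_on_cells:
  fixes f :: "real \<Rightarrow> real"
  assumes Q: "partition_on UNIV Q" "finite Q" "\<And>A. A \<in> Q \<Longrightarrow> A \<in> sets borel"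
    and f: "\<And>x y. quantizer Q x = quantizer Q y \<Longrightarrow> f x = f y"
  shows "f \<in> borel_measurable borel"
proof -
  have "f x = (\<lambda>n. f (SOME y. cell_index Q y = n)) (cell_index Q x)" for x
  proof -
    have "cell_index Q (SOME y. cell_index Q y = cell_index Q x) = cell_index Q x" by (rule someI) simp
    then show ?thesis using cell_index_eq_iff[OF Q(1,2)] f by metis
  qed
  then have "f = (\<lambda>x. (\<lambda>n. f (SOME y. cell_index Q y = n)) (cell_index Q x))" by blast
  also have "\<dots> \<in> borel_measurable borel"
    using measurable_cell_index[OF Q] by (rule measurable_compose) simp_all
  finally show ?thesis .
qed

text \<open>A representative of the cell of \<open>x\<close> inside \<open>[-D, D]\<close>. It depends on the cell only; the value 0
  serves cells outside the interval.\<close>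

definition cell_point :: "real \<Rightarrow> real set set \<Rightarrow> real \<Rightarrow> real" where
  "cell_point D Q x = (let A = quantizer Q x \<inter> {-D..D} in if A = {} then 0 else SOME y. y \<in> A)"

lemma cell_point_bounded:
  assumes "D \<ge> 0"
  shows "\<bar>cell_point D Q x\<bar> \<le> D"
proof (cases "quantizer Q x \<inter> {-D..D} = {}")
  case True
  then show ?thesis using assms by (simp add: cell_point_def)
next
  case False
  then have "(SOME y. y \<in> quantizer Q x \<inter> {-D..D}) \<in> quantizer Q x \<inter> {-D..D}" by (rule some_in_eq[THEN iffD2])
  with False have "cell_point D Q x \<in> {-D..D}" unfolding cell_point_def Let_def by auto
  then show ?thesis by auto
qed

lemma cell_point_mem:
  assumes "partition_on UNIV Q" "\<bar>x\<bar> \<le> D"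
  shows "\<bar>cell_point D Q x\<bar> \<le> D \<and> quantizer Q (cell_point D Q x) = quantizer Q x"
proof -
  have "x \<in> quantizer Q x \<inter> {-D..D}" using assms quantizer_mem(2) by auto
  moreover from this have "(SOME y. y \<in> quantizer Q x \<inter> {-D..D}) \<in> quantizer Q x \<inter> {-D..D}" by (rule someI)
  ultimately have "cell_point D Q x \<in> quantizer Q x \<inter> {-D..D}"
    unfolding cell_point_def Let_def by auto
  then show ?thesis using quantizer_eq[OF assms(1) quantizer_mem(1)[OF assms(1)]] by auto
qed

locale refining_partitions =
  fixes P :: "nat \<Rightarrow> real set set"
  assumes P: "partition_sequence P"
begin

lemma P_partition: "k \<ge> 1 \<Longrightarrow> partition_on UNIV (P k)"
  and P_finite: "k \<ge> 1 \<Longrightarrow> finite (P k)"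
  and P_semiclosed: "k \<ge> 1 \<Longrightarrow> A \<in> P k \<Longrightarrow> right_semiclosed A"
  and P_borel: "k \<ge> 1 \<Longrightarrow> A \<in> P k \<Longrightarrow> A \<in> sets borel"
  using P borel_right_semiclosed by (auto simp: partition_sequence_def)

lemma quantizer_mono:
  assumes "1 \<le> j" "j \<le> k" "quantizer (P k) x = quantizer (P k) y"
  shows "quantizer (P j) x = quantizer (P j) y"
  using assms(2,1,3)
proof (induction rule: dec_induct)
  case (step k)
  have "quantizer (P k) x = quantizer (P k) y"
    by (rule quantizer_refine[OF P_partition P_partition[of "Suc k"]])
       (use step P in \<open>auto simp: partition_sequence_def\<close>)
  with step show ?case by blast
qed

text \<open>Otherwise no Borel set would separate the two points, although singletons are Borel.\<close>

lemma partitions_separate_points: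
  assumes "x \<noteq> y"
  shows "\<exists>k\<ge>1. quantizer (P k) x \<noteq> quantizer (P k) y"
proof (rule ccontr)
  assume "\<not> ?thesis"
  then have same: "\<And>k. k \<ge> 1 \<Longrightarrow> quantizer (P k) x = quantizer (P k) y" by blast
  have "{x} \<in> sigma_sets UNIV (\<Union>k\<in>{1..}. sigma_sets UNIV (P k))"
    using P by (simp add: partition_sequence_def)
  then have "x \<in> {x} \<longleftrightarrow> y \<in> {x}"
  proof (rule sigma_sets_indistinguishable)
    fix G assume "G \<in> (\<Union>k\<in>{1..}. sigma_sets UNIV (P k))"
    then obtain k where k: "k \<ge> 1" "G \<in> sigma_sets UNIV (P k)" by auto
    show "x \<in> G \<longleftrightarrow> y \<in> G"
      using k(2)
    proof (rule sigma_sets_indistinguishable)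
      fix A assume "A \<in> P k"
      then show "x \<in> A \<longleftrightarrow> y \<in> A"
        using same[OF k(1)] quantizer_mem[OF P_partition[OF k(1)]] quantizer_eq[OF P_partition[OF k(1)]] by metis
    qed
  qed
  with assms show False by simp
qed

text \<open>Lay a grid of width \<open>e / 2\<close> over \<open>[-D, D]\<close> and pick a level at which all neighbouring grid points
  lie in different cells. A cell is an interval, so if it contained two points more than \<open>e\<close>
  apart it would contain two neighbouring grid points.\<close>

lemma mesh_tendsto_0:
  assumes e: "e > 0"
  shows "\<exists>m\<ge>1. \<forall>k\<ge>m. \<forall>x y. \<bar>x\<bar> \<le> D \<longrightarrow> \<bar>y\<bar> \<le> D \<longrightarrow> quantizer (P k) x = quantizer (P k) y \<longrightarrow> \<bar>x - y\<bar> \<le> e"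
proof -
  define z where "z i = - D + real i * (e / 2)" for i :: nat
  have "\<forall>i. \<exists>k\<ge>1. quantizer (P k) (z i) \<noteq> quantizer (P k) (z (Suc i))"
    using e by (intro allI partitions_separate_points) (simp add: z_def)
  then obtain K where K: "\<And>i. K i \<ge> 1" "\<And>i. quantizer (P (K i)) (z i) \<noteq> quantizer (P (K i)) (z (Suc i))"
    by metis
  obtain n where n: "real n \<ge> 2 * D / (e / 2)" using real_arch_simple by blast
  \<comment> \<open>The sum is only an upper bound for the finitely many levels \<open>K i\<close>.\<close>
  define m where "m = Suc (\<Sum>i\<le>n. K i)"
  have mK: "K i \<le> m" if "i \<le> n" for i
    using member_le_sum[of i "{..n}" K] that by (simp add: m_def)
  have key: "y - x \<le> e" if k: "k \<ge> m" and xy: "\<bar>x\<bar> \<le> D" "\<bar>y\<bar> \<le> D" "quantizer (P k) x = quantizer (P k) y" for k x y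
  proof (rule ccontr)
    assume gap: "\<not> y - x \<le> e"
    \<comment> \<open>\<open>z i\<close> is the first grid point to the right of \<open>x\<close>; the next one is still to the left of \<open>y\<close>.\<close>
    define i where "i = nat \<lceil>(x + D) / (e / 2)\<rceil>"
    have nn: "(x + D) / (e / 2) \<ge> 0" using xy e by simp
    have i1: "(x + D) / (e / 2) \<le> real i" "real i < (x + D) / (e / 2) + 1"
      unfolding i_def using nn by (simp_all add: of_nat_nat) linarith+
    have xz: "x \<le> z i" using i1(1) e by (simp add: z_def pos_divide_le_eq)
    have "real i - 1 < (x + D) / (e / 2)" using i1(2) by simp
    then have "(real i - 1) * (e / 2) < x + D" using e by (simp only: pos_less_divide_eq half_gt_zero)
    then have zy: "z (Suc i) \<le> y" using gap e by (simp add: z_def field_simps)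
    have "i \<le> n"
    proof -
      have "(real i) * (e / 2) \<le> 2 * D" using zy xy e by (simp add: z_def field_simps)
      then have "real i \<le> 2 * D / (e / 2)" using e by (simp only: pos_le_divide_eq half_gt_zero)
      then show ?thesis using n by linarith
    qed
    then have Kk: "K i \<le> k" using mK k by (meson le_trans)
    have k1: "k \<ge> 1" using k by (simp add: m_def)
    have zz: "z i \<le> z (Suc i)" using e by (simp add: z_def)
    define A where "A = quantizer (P k) x"
    have A: "A \<in> P k" "x \<in> A" "y \<in> A"
      using quantizer_mem[OF P_partition[OF k1]] xy(3) by (auto simp: A_def)
    have "z i \<in> A" "z (Suc i) \<in> A"
      using right_semiclosed_between[OF P_semiclosed[OF k1 A(1)] A(2,3)] xz zy zz by auto
    then have "quantizer (P k) (z i) = quantizer (P k) (z (Suc i))"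
      using quantizer_eq[OF P_partition[OF k1] A(1)] by simp
    then show False using quantizer_mono[OF K(1) Kk] K(2) by blast
  qed
  show ?thesis
  proof (intro exI[of _ m] conjI allI impI)
    fix k x y assume "m \<le> k" "\<bar>x\<bar> \<le> D" "\<bar>y\<bar> \<le> D" "quantizer (P k) x = quantizer (P k) y"
    then show "\<bar>x - y\<bar> \<le> e" using key[of k x y] key[of k y x] by simp
  qed (simp add: m_def)
qed

definition mesh_error :: "real \<Rightarrow> nat \<Rightarrow> real" where
  "mesh_error D k = (SUP x\<in>{-D..D}. \<bar>cell_point D (P (Suc k)) x - x\<bar>)"

lemma mesh_error_bound:
  assumes "\<bar>x\<bar> \<le> D"
  shows "\<bar>cell_point D (P (Suc k)) x - x\<bar> \<le> mesh_error D k"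
  unfolding mesh_error_def
proof (rule cSUP_upper)
  show "bdd_above ((\<lambda>x. \<bar>cell_point D (P (Suc k)) x - x\<bar>) ` {-D..D})"
  proof (rule bdd_aboveI2)
    fix x assume "x \<in> {-D..D}"
    then show "\<bar>cell_point D (P (Suc k)) x - x\<bar> \<le> 2 * D"
      using cell_point_bounded[of D "P (Suc k)" x] by (auto simp: abs_le_iff)
  qed
qed (use assms in auto)

lemma mesh_error_tendsto_0:
  assumes D: "D \<ge> 0"
  shows "mesh_error D \<longlonglongrightarrow> 0"
proof (rule LIMSEQ_I)
  fix r :: real assume "r > 0"
  then have "r / 2 > 0" by simp
  from mesh_tendsto_0[OF this, of D] obtain m where
    m: "\<And>k x y. k \<ge> m \<Longrightarrow> \<bar>x\<bar> \<le> D \<Longrightarrow> \<bar>y\<bar> \<le> D \<Longrightarrow> quantizer (P k) x = quantizer (P k) y \<Longrightarrow> \<bar>x - y\<bar> \<le> r / 2"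
    by blast
  have "norm (mesh_error D k - 0) < r" if k: "k \<ge> m" for k
  proof -
    have "mesh_error D k \<le> r / 2" unfolding mesh_error_def
    proof (rule cSUP_least)
      fix x assume "x \<in> {-D..D}"
      then have "\<bar>x\<bar> \<le> D" by auto
      then show "\<bar>cell_point D (P (Suc k)) x - x\<bar> \<le> r / 2"
        using cell_point_mem[OF P_partition[of "Suc k"], of x D] k by (intro m[of "Suc k"]) auto
    qed (use D in auto)
    moreover have "0 \<le> mesh_error D k" using mesh_error_bound[of 0 D k] D by linarith
    ultimately show ?thesis using \<open>r > 0\<close> by simp
  qed
  then show "\<exists>no. \<forall>k\<ge>no. norm (mesh_error D k - 0) < r" by blast
qed

lemma cell_point_borel: "cell_point D (P (Suc k)) \<in> borel_measurable borel"
  by (rule borel_measurable_if_constant_on_cells[OF P_partition[of "Suc k"] P_finite P_borel])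
     (auto simp: cell_point_def)

end

section \<open>Return times and what the quantized past determines\<close>

definition returns :: "real set set \<Rightarrow> (int \<Rightarrow> real) \<Rightarrow> nat \<Rightarrow> nat \<Rightarrow> bool" where
  "returns Q x l t \<longleftrightarrow> t > 0 \<and>
     (\<forall>i\<in>{1..l}. quantizer Q (x (- int i - int t)) = quantizer Q (x (- int i)))"

lemma recurrence_time_eq_Least: "recurrence_time Q x l = (LEAST t. returns Q x l t)"
proof -
  have shift: "[a - s..b - s] = map (\<lambda>i. i - s) [a..b]" for a b s :: int
    by (rule nth_equalityI) (auto simp: nth_upto)
  have "map (quantizer Q) (block x (- int l - int t) (- 1 - int t)) = map (quantizer Q) (block x (- int l) (- 1))
      \<longleftrightarrow> (\<forall>i\<in>{1..l}. quantizer Q (x (- int i - int t)) = quantizer Q (x (- int i)))" for t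
  proof -
    have "map (quantizer Q) (block x (- int l - int t) (- 1 - int t)) = map (quantizer Q) (block x (- int l) (- 1))
      \<longleftrightarrow> (\<forall>j\<in>{- int l..-1}. quantizer Q (x (j - int t)) = quantizer Q (x j))"
      unfolding block_def shift by (simp add: comp_def)
    also have "\<dots> \<longleftrightarrow> (\<forall>i\<in>{1..l}. quantizer Q (x (- int i - int t)) = quantizer Q (x (- int i)))"
    proof (intro iffI ballI)
      fix i assume "\<forall>j\<in>{- int l..-1}. quantizer Q (x (j - int t)) = quantizer Q (x j)" "i \<in> {1..l}"
      then show "quantizer Q (x (- int i - int t)) = quantizer Q (x (- int i))"
        by (auto dest!: bspec[of _ _ "- int i"])
    next
      fix j assume *: "\<forall>i\<in>{1..l}. quantizer Q (x (- int i - int t)) = quantizer Q (x (- int i))" "j \<in> {- int l..-1}"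
      then have "nat (- j) \<in> {1..l}" "- int (nat (- j)) = j" by auto
      with * show "quantizer Q (x (j - int t)) = quantizer Q (x j)" by metis
    qed
    finally show ?thesis .
  qed
  then show ?thesis by (simp add: recurrence_time_def returns_def)
qed

context refining_partitions
begin

text \<open>All the searches for return times succeed; elsewhere the return times are unspecified.\<close>

definition recurrent :: "(int \<Rightarrow> real) \<Rightarrow> bool" where
  "recurrent x \<longleftrightarrow> (\<forall>k. \<exists>t. returns (P (Suc k)) x (lam P x k) t)"

lemma recurrent_returns:
  assumes "recurrent x"
  shows "returns (P (Suc k)) x (lam P x k) (recurrence_time (P (Suc k)) x (lam P x k))"
  unfolding recurrence_time_eq_Least
  by (rule LeastI_ex[of "returns (P (Suc k)) x (lam P x k)"]) (use assms in \<open>simp add: recurrent_def\<close>)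

lemma recurrence_time_pos: "recurrent x \<Longrightarrow> recurrence_time (P (Suc k)) x (lam P x k) > 0"
  using recurrent_returns by (simp add: returns_def)

lemma lam_mono: "j \<le> k \<Longrightarrow> lam P x j \<le> lam P x k"
  by (induction k rule: dec_induct) simp_all

lemma lam_ge: "recurrent x \<Longrightarrow> Suc k \<le> lam P x k"
proof (induction k)
  case (Suc k)
  then show ?case using recurrence_time_pos[of x k] by simp
qed simp

definition agree :: "nat \<Rightarrow> nat \<Rightarrow> (int \<Rightarrow> real) \<Rightarrow> (int \<Rightarrow> real) \<Rightarrow> bool" where
  "agree k l x y \<longleftrightarrow> (\<forall>i\<in>{1..l}. quantizer (P k) (x (- int i)) = quantizer (P k) (y (- int i)))"

text \<open>The search that produces \<open>\<lambda>\<^sub>1, \<dots>, \<lambda>\<^sub>k\<close> never looks further back than \<open>\<lambda>\<^sub>k\<close> and only at cells of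
  levels up to \<open>k\<close>. A path that agrees with \<open>x\<close> there therefore runs through the same search.
  In particular the searches up to level \<open>k\<close> also succeed on that path.\<close>

lemma lam_determined:
  assumes x: "recurrent x" and ag: "agree (Suc k) (lam P x k) x y"
  shows "j \<le> k \<Longrightarrow> lam P y j = lam P x j"
proof (induction j)
  case (Suc j)
  define l where "l = lam P x j"
  have ly: "lam P y j = l" using Suc by (simp add: l_def)
  define t where "t = recurrence_time (P (Suc j)) x l"
  have t: "returns (P (Suc j)) x l t" unfolding t_def l_def by (rule recurrent_returns[OF x])
  have tl: "t + l \<le> lam P x k" using lam_mono[OF Suc.prems, of x] by (simp add: t_def l_def)
  have agj: "quantizer (P (Suc j)) (x (- int i)) = quantizer (P (Suc j)) (y (- int i))"
    if "1 \<le> i" "i \<le> t + l" for i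
    using ag that tl Suc.prems by (intro quantizer_mono[of "Suc j" "Suc k"]) (auto simp: agree_def)
  have eq: "returns (P (Suc j)) x l s \<longleftrightarrow> returns (P (Suc j)) y l s" if s: "s \<le> t" for s
  proof -
    have "quantizer (P (Suc j)) (x (- int i - int s)) = quantizer (P (Suc j)) (y (- int i - int s))"
         "quantizer (P (Suc j)) (x (- int i)) = quantizer (P (Suc j)) (y (- int i))"
      if "i \<in> {1..l}" for i
      using agj[of "i + s"] agj[of i] that s by (auto simp: algebra_simps)
    then show ?thesis by (simp add: returns_def)
  qed
  have "recurrence_time (P (Suc j)) y l = t"
    unfolding recurrence_time_eq_Least
  proof (rule Least_equality)
    show "returns (P (Suc j)) y l t" using t eq by simp
    fix s assume s: "returns (P (Suc j)) y l s"
    show "t \<le> s"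
    proof (rule ccontr)
      assume "\<not> t \<le> s"
      then have "returns (P (Suc j)) x l s" using s eq by simp
      then have "t \<le> s" unfolding t_def recurrence_time_eq_Least by (rule Least_le)
      with \<open>\<not> t \<le> s\<close> show False by simp
    qed
  qed
  then show ?case using ly by (simp add: t_def l_def)
qed simp

definition cells :: "nat \<Rightarrow> nat \<Rightarrow> (int \<Rightarrow> real) \<Rightarrow> nat list" where
  "cells k l x = map (\<lambda>i. cell_index (P (Suc k)) (x (- int (Suc i)))) [0..<l]"

text \<open>The information available at stage \<open>k\<close>: the last \<open>\<lambda>\<^sub>k\<close> values, quantized at level \<open>k + 1\<close>, the
  level of the next search. The empty list marks the paths on which some search fails; no recurrent
  path has it, because its window is nonempty. As a result each code determines the earlier codes on
  every path and not only almost surely, so the codes generate a filtration.\<close>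

definition code :: "nat \<Rightarrow> (int \<Rightarrow> real) \<Rightarrow> nat list" where
  "code k x = (if recurrent x then cells k (lam P x k) x else [])"

lemma code_eq_Nil_iff: "code k x = [] \<longleftrightarrow> \<not> recurrent x"
  using lam_ge[of x k] by (auto simp: code_def cells_def)

lemma cells_eq_iff: "cells k l x = cells k l y \<longleftrightarrow> agree (Suc k) l x y"
proof -
  have "(\<forall>i\<in>{..<l}. quantizer (P (Suc k)) (x (- int (Suc i))) = quantizer (P (Suc k)) (y (- int (Suc i))))
     \<longleftrightarrow> agree (Suc k) l x y"
    unfolding agree_def image_Suc_lessThan[symmetric] by simp
  then show ?thesis
    using cell_index_eq_iff[OF P_partition P_finite, of "Suc k"] by (auto simp: cells_def atLeast0LessThan)
qed

lemma code_eq_iff: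
  assumes x: "recurrent x" and y: "recurrent y"
  shows "code k y = code k x \<longleftrightarrow> agree (Suc k) (lam P x k) x y"
proof
  assume eq: "code k y = code k x"
  then have "length (code k y) = length (code k x)" by simp
  then have "lam P y k = lam P x k" using x y by (simp add: code_def cells_def)
  then show "agree (Suc k) (lam P x k) x y"
    using eq x y cells_eq_iff[of k "lam P x k" x y] by (simp add: code_def)
next
  assume ag: "agree (Suc k) (lam P x k) x y"
  then have "lam P y k = lam P x k" using lam_determined[OF x] by blast
  then show "code k y = code k x"
    using ag x y cells_eq_iff[of k "lam P x k" x y] by (simp add: code_def)
qed

lemma code_determines:
  assumes eq: "code k x = code k y"
  shows "recurrent x \<longleftrightarrow> recurrent y"
    and "recurrent x \<Longrightarrow> j \<le> k \<Longrightarrow> lam P x j = lam P y j"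
    and "recurrent x \<Longrightarrow> 1 \<le> i \<Longrightarrow> i \<le> lam P x k \<Longrightarrow> 1 \<le> j \<Longrightarrow> j \<le> Suc k \<Longrightarrow>
       quantizer (P j) (x (- int i)) = quantizer (P j) (y (- int i))"
proof -
  show r: "recurrent x \<longleftrightarrow> recurrent y" using eq code_eq_Nil_iff[of k] by metis
  assume x: "recurrent x"
  then have ag: "agree (Suc k) (lam P x k) x y" using r eq code_eq_iff by metis
  show "j \<le> k \<Longrightarrow> lam P x j = lam P y j" using lam_determined[OF x ag] by simp
  show "1 \<le> i \<Longrightarrow> i \<le> lam P x k \<Longrightarrow> 1 \<le> j \<Longrightarrow> j \<le> Suc k \<Longrightarrow>
       quantizer (P j) (x (- int i)) = quantizer (P j) (y (- int i))"
    using ag by (intro quantizer_mono[of j "Suc k"]) (auto simp: agree_def)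
qed

lemma code_mono:
  assumes "code (Suc k) x = code (Suc k) y"
  shows "code k x = code k y"
proof (cases "recurrent x")
  case True
  note d = code_determines[OF assms]
  have "agree (Suc k) (lam P x k) x y"
    using d(3)[OF True, of _ "Suc k"] lam_mono[of k "Suc k" x] by (auto simp: agree_def)
  then show ?thesis using code_eq_iff[OF True] d(1) True by metis
next
  case False
  then show ?thesis using code_determines(1)[OF assms] by (simp add: code_def)
qed

text \<open>The return time is the difference of two window lengths and lies within the later window.\<close>

lemma code_determines_return:
  assumes eq: "code (Suc k) x = code (Suc k) y" and x: "recurrent x"
  shows "quantizer (P (Suc k)) (x (- int (tau P x (Suc k)))) = quantizer (P (Suc k)) (y (- int (tau P y (Suc k))))"
proof -
  note d = code_determines[OF eq]
  have "lam P x k = lam P y k" "lam P x (Suc k) = lam P y (Suc k)" 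
    by (rule d(2)[OF x]; simp)+
  moreover have "tau P z (Suc k) = lam P z (Suc k) - lam P z k" for z by (simp add: tau_def)
  ultimately have "tau P y (Suc k) = tau P x (Suc k)" by simp
  moreover have "1 \<le> tau P x (Suc k)" "tau P x (Suc k) \<le> lam P x (Suc k)"
    using recurrence_time_pos[OF x, of k] by (auto simp: tau_def)
  ultimately show ?thesis using d(3)[OF x, of "tau P x (Suc k)" "Suc k"] by simp
qed

context
  fixes N :: "'a measure" and Y :: "int \<Rightarrow> 'a \<Rightarrow> real"
  assumes Y: "\<And>i. i < 0 \<Longrightarrow> Y i \<in> borel_measurable N"
begin

text \<open>The results in this context hold for every \<open>\<sigma>\<close>-algebra that makes the coordinates with negative
  index measurable. They are used for the underlying space, for the law on path space, and for the
  past.\<close>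

lemma measurable_cell_index_path:
  "i < 0 \<Longrightarrow> (\<lambda>\<omega>. cell_index (P (Suc k)) (Y i \<omega>)) \<in> N \<rightarrow>\<^sub>M count_space UNIV"
  using Y by (rule measurable_compose[OF _ measurable_cell_index[OF P_partition P_finite P_borel]]) auto

lemma pred_returns: "Measurable.pred N (\<lambda>\<omega>. returns (P (Suc k)) (\<lambda>n. Y n \<omega>) l t)"
proof -
  have cells: "(\<lambda>\<omega>. cell_index (P (Suc k)) (Y (- int (Suc i)) \<omega>)) \<in> N \<rightarrow>\<^sub>M count_space UNIV"
       "(\<lambda>\<omega>. cell_index (P (Suc k)) (Y (- int (Suc i) - int t) \<omega>)) \<in> N \<rightarrow>\<^sub>M count_space UNIV" for i
    by (rule measurable_cell_index_path; simp)+
  have eq: "Measurable.pred N (\<lambda>\<omega>. cell_index (P (Suc k)) (Y (- int (Suc i) - int t) \<omega>)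
      = cell_index (P (Suc k)) (Y (- int (Suc i)) \<omega>))" for i
  proof (rule measurable_compose_countable[where f="\<lambda>n \<omega>. n = cell_index (P (Suc k)) (Y (- int (Suc i)) \<omega>)", OF _ cells(2)])
    show "Measurable.pred N (\<lambda>\<omega>. n = cell_index (P (Suc k)) (Y (- int (Suc i)) \<omega>))" for n
      using cells(1) by (rule pred_eq_const2) simp
  qed
  have "(\<lambda>\<omega>. returns (P (Suc k)) (\<lambda>n. Y n \<omega>) l t) = (\<lambda>\<omega>. t > 0 \<and>
     (\<forall>i\<in>{..<l}. cell_index (P (Suc k)) (Y (- int (Suc i) - int t) \<omega>) = cell_index (P (Suc k)) (Y (- int (Suc i)) \<omega>)))"
    using cell_index_eq_iff[OF P_partition P_finite, of "Suc k"]
    unfolding returns_def image_Suc_lessThan[symmetric] by simp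
  also have "Measurable.pred N \<dots>"
    by (intro pred_intros_logic(3) pred_intros_finite(3) eq) simp_all
  finally show ?thesis .
qed

lemma measurable_recurrence_time:
  assumes "f \<in> N \<rightarrow>\<^sub>M count_space UNIV"
  shows "(\<lambda>\<omega>. recurrence_time (P (Suc k)) (\<lambda>n. Y n \<omega>) (f \<omega>)) \<in> N \<rightarrow>\<^sub>M count_space UNIV"
proof (rule measurable_compose_countable[where f="\<lambda>l \<omega>. recurrence_time (P (Suc k)) (\<lambda>n. Y n \<omega>) l", OF _ assms])
  show "(\<lambda>\<omega>. recurrence_time (P (Suc k)) (\<lambda>n. Y n \<omega>) l) \<in> N \<rightarrow>\<^sub>M count_space UNIV" for l
    unfolding recurrence_time_eq_Least by (intro measurable_Least pred_returns)
qed

lemma measurable_lam: "(\<lambda>\<omega>. lam P (\<lambda>n. Y n \<omega>) k) \<in> N \<rightarrow>\<^sub>M count_space UNIV"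
proof (induction k)
  case (Suc k)
  then show ?case using measurable_recurrence_time[OF Suc, of k] by simp
qed simp

lemma measurable_tau: "(\<lambda>\<omega>. tau P (\<lambda>n. Y n \<omega>) (Suc k)) \<in> N \<rightarrow>\<^sub>M count_space UNIV"
  by (simp add: tau_def measurable_recurrence_time measurable_lam)

lemma pred_recurrent: "Measurable.pred N (\<lambda>\<omega>. recurrent (\<lambda>n. Y n \<omega>))"
proof -
  have [measurable]: "Measurable.pred N (\<lambda>\<omega>. returns (P (Suc k)) (\<lambda>n. Y n \<omega>) (lam P (\<lambda>n. Y n \<omega>) k) t)" for k t
    by (rule measurable_compose_countable[where f="\<lambda>l \<omega>. returns (P (Suc k)) (\<lambda>n. Y n \<omega>) l t",
          OF pred_returns measurable_lam])
  show ?thesis unfolding recurrent_def by measurable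
qed

lemma measurable_cells: "(\<lambda>\<omega>. cells k l (\<lambda>n. Y n \<omega>)) \<in> N \<rightarrow>\<^sub>M count_space UNIV"
proof (induction l)
  case (Suc l)
  have "(\<lambda>\<omega>. cell_index (P (Suc k)) (Y (- int (Suc l)) \<omega>)) \<in> N \<rightarrow>\<^sub>M count_space UNIV"
    by (rule measurable_cell_index_path) simp
  then have "(\<lambda>\<omega>. b @ [cell_index (P (Suc k)) (Y (- int (Suc l)) \<omega>)]) \<in> N \<rightarrow>\<^sub>M count_space UNIV" for b
    by (rule measurable_compose) simp
  then have "(\<lambda>\<omega>. cells k l (\<lambda>n. Y n \<omega>) @ [cell_index (P (Suc k)) (Y (- int (Suc l)) \<omega>)])
      \<in> N \<rightarrow>\<^sub>M count_space UNIV"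
    by (rule measurable_compose_countable[where
          f="\<lambda>b \<omega>. b @ [cell_index (P (Suc k)) (Y (- int (Suc l)) \<omega>)]", OF _ Suc])
  then show ?case by (simp add: cells_def)
qed (simp add: cells_def)

lemma measurable_code: "(\<lambda>\<omega>. code k (\<lambda>n. Y n \<omega>)) \<in> N \<rightarrow>\<^sub>M count_space UNIV"
proof -
  have "(\<lambda>\<omega>. cells k (lam P (\<lambda>n. Y n \<omega>) k) (\<lambda>n. Y n \<omega>)) \<in> N \<rightarrow>\<^sub>M count_space UNIV"
    by (rule measurable_compose_countable[where
          f="\<lambda>l \<omega>. cells k l (\<lambda>n. Y n \<omega>)", OF measurable_cells measurable_lam])
  moreover have "{\<omega>\<in>space N. recurrent (\<lambda>n. Y n \<omega>)} \<in> sets N"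
    using pred_recurrent by (simp only: pred_def)
  ultimately show ?thesis
    unfolding code_def by (intro measurable_If) simp_all
qed

end

end

section \<open>First return under a measure-preserving action\<close>

text \<open>The integer powers of an invertible measure-preserving transformation.\<close>

locale measure_preserving_action = prob_space N for N :: "'b measure" +
  fixes T :: "int \<Rightarrow> 'b \<Rightarrow> 'b"
  assumes T_measurable [measurable]: "\<And>m. T m \<in> N \<rightarrow>\<^sub>M N"
    and T_preserves: "\<And>m. distr N N (T m) = N"
    and T_add: "\<And>a b x. T a (T b x) = T (a + b) x"
    and T_zero: "\<And>x. T 0 x = x"
begin

lemma integral_T:
  fixes g :: "'b \<Rightarrow> real"
  assumes "g \<in> borel_measurable N"
  shows "(\<integral>x. g (T m x) \<partial>N) = (\<integral>x. g x \<partial>N)"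
  using integral_distr[OF T_measurable assms, of m] by (simp add: T_preserves)

lemma measure_T:
  assumes [measurable]: "A \<in> sets N"
  shows "measure N {x\<in>space N. T m x \<in> A} = measure N A"
proof -
  have "measure N A = measure (distr N N (T m)) A" by (simp add: T_preserves)
  also have "\<dots> = measure N (T m -` A \<inter> space N)" by (rule measure_distr) auto
  also have "T m -` A \<inter> space N = {x\<in>space N. T m x \<in> A}" by auto
  finally show ?thesis by simp
qed

text \<open>The points of \<open>A\<close> that never return form a wandering set: its translates are disjoint and have equal
  measure, so in a probability space this measure is zero.\<close>

lemma poincare_recurrence:
  assumes [measurable]: "A \<in> sets N"
  shows "AE x in N. x \<in> A \<longrightarrow> (\<exists>t::nat. t > 0 \<and> T (c * int t) x \<in> A)"
proof -
  define W where "W = {x\<in>space N. x \<in> A \<and> \<not> (\<exists>t::nat. t > 0 \<and> T (c * int t) x \<in> A)}"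
  have W [measurable]: "W \<in> sets N" unfolding W_def by measurable
  define V where "V s = {x\<in>space N. T (c * int s) x \<in> W}" for s
  have V [measurable]: "V s \<in> sets N" for s unfolding V_def by measurable
  have aux: "V s \<inter> V s' = {}" if "s < s'" for s s'
  proof -
    have "T (c * int (s' - s)) (T (c * int s) x) = T (c * int s') x" for x
      using that by (simp add: T_add algebra_simps of_nat_diff)
    moreover have "T (c * int s') x \<in> A" if "x \<in> V s'" for x using that by (simp add: V_def W_def)
    moreover have "T (c * int t) (T (c * int s) x) \<notin> A" if "x \<in> V s" "t > 0" for x t
      using that unfolding V_def W_def by blast
    moreover have "0 < s' - s" using that by simp
    ultimately show ?thesis by (metis disjoint_iff)
  qed
  have "disjoint_family V"
    unfolding disjoint_family_on_def using aux by (metis Int_commute linorder_neqE_nat)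
  then have "(\<lambda>s. measure N (V s)) sums measure N (\<Union>s. V s)"
    by (intro finite_measure_UNION) auto
  moreover have "measure N (V s) = measure N W" for s unfolding V_def by (rule measure_T) simp
  ultimately have "summable (\<lambda>s::nat. measure N W)" by (simp add: sums_iff)
  then have "measure N W = 0" using summable_LIMSEQ_zero LIMSEQ_const_iff by blast
  then have "AE x in N. x \<notin> W" by (intro AE_not_in) (auto simp: null_sets_def emeasure_eq_measure)
  then show ?thesis using AE_space by eventually_elim (auto simp: W_def)
qed

text \<open>Split \<open>A\<close> into the sets \<open>B\<close> on which the backward first return takes exactly \<open>t + 1\<close> steps. Moving
  by \<open>t + 1\<close> steps maps such a piece onto the set \<open>C\<close> of points of \<open>A\<close> whose forward first return takes
  \<open>t + 1\<close> steps. By Poincare recurrence in both directions the sets \<open>B\<close> and the sets \<open>C\<close> each exhaust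
  \<open>A\<close> up to null sets.\<close>

theorem first_return_preserves_integral:
  fixes g :: "'b \<Rightarrow> real"
  assumes A [measurable]: "A \<in> sets N" and g [measurable]: "g \<in> borel_measurable N"
    and bounded: "\<And>x. \<bar>g x\<bar> \<le> K"
  shows "(LINT x:A|N. g (T (- int (LEAST t. t > 0 \<and> T (- int t) x \<in> A)) x)) = (LINT x:A|N. g x)"
proof -
  define r where "r x = (LEAST t. t > 0 \<and> T (- int t) x \<in> A)" for x
  define B where "B t = {x\<in>space N. x \<in> A \<and> T (- int (Suc t)) x \<in> A \<and>
     (\<forall>s\<in>{0<..<Suc t}. T (- int s) x \<notin> A)}" for t
  define C where "C t = {x\<in>space N. x \<in> A \<and> T (int (Suc t)) x \<in> A \<and>
     (\<forall>s\<in>{0<..<Suc t}. T (int s) x \<notin> A)}" for t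
  have B [measurable]: "B t \<in> sets N" and C [measurable]: "C t \<in> sets N" for t
  proof -
    have Tm: "{x\<in>space N. T m x \<in> A} \<in> sets N" for m by measurable
    have "B t = A \<inter> {x\<in>space N. T (- int (Suc t)) x \<in> A}
        - (\<Union>s\<in>{0<..<Suc t}. {x\<in>space N. T (- int s) x \<in> A})"
      using sets.sets_into_space[OF A] by (auto simp: B_def)
    also have "\<dots> \<in> sets N" by (intro sets.Diff sets.Int A sets.finite_UN Tm) auto
    finally show "B t \<in> sets N" .
    have "C t = A \<inter> {x\<in>space N. T (int (Suc t)) x \<in> A}
        - (\<Union>s\<in>{0<..<Suc t}. {x\<in>space N. T (int s) x \<in> A})"
      using sets.sets_into_space[OF A] by (auto simp: C_def)
    also have "\<dots> \<in> sets N" by (intro sets.Diff sets.Int A sets.finite_UN Tm) auto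
    finally show "C t \<in> sets N" .
  qed
  have r_measurable [measurable]: "r \<in> N \<rightarrow>\<^sub>M count_space UNIV" 
    unfolding r_def by (rule measurable_Least) measurable
  have gr [measurable]: "(\<lambda>x. g (T (- int (r x)) x)) \<in> borel_measurable N"
    by (rule measurable_compose_countable[where f="\<lambda>t x. g (T (- int t) x)", OF _ r_measurable]) measurable
  have rB: "r x = Suc t" if "x \<in> B t" for x t
    unfolding r_def
  proof (rule Least_equality)
    show "0 < Suc t \<and> T (- int (Suc t)) x \<in> A" using that by (simp add: B_def)
    fix s assume "0 < s \<and> T (- int s) x \<in> A"
    with that show "Suc t \<le> s" unfolding B_def by (metis (mono_tags, lifting) greaterThanLessThan_iff mem_Collect_eq not_le)
  qed
  have B_disj: "B i \<inter> B j = {}" if "i \<noteq> j" for i j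
    using rB that by (metis disjoint_iff nat.inject)
  have C_aux: "C i \<inter> C j = {}" if "i < j" for i j
  proof -
    have "T (int (Suc i)) x \<notin> A" if "x \<in> C j" for x
    proof -
      have "Suc i \<in> {0<..<Suc j}" using \<open>i < j\<close> by simp
      with that show ?thesis unfolding C_def by blast
    qed
    then show ?thesis unfolding C_def by blast
  qed
  have C_disj: "C i \<inter> C j = {}" if "i \<noteq> j" for i j
    using C_aux that by (metis Int_commute linorder_neqE_nat)
  have AB: "AE x in N. x \<in> A \<longleftrightarrow> x \<in> (\<Union>t. B t)"
    using poincare_recurrence[OF A, of "-1"] AE_space
  proof eventually_elim
    case (elim x)
    have "x \<in> (\<Union>t. B t)" if "x \<in> A"
    proof -
      have ex: "\<exists>t. t > 0 \<and> T (- int t) x \<in> A" using elim that by auto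
      have r: "r x > 0 \<and> T (- int (r x)) x \<in> A" unfolding r_def by (rule LeastI_ex[OF ex])
      have "T (- int s) x \<notin> A" if "0 < s" "s < r x" for s
        using not_less_Least[of s "\<lambda>t. t > 0 \<and> T (- int t) x \<in> A"] that by (auto simp: r_def)
      then have "x \<in> B (r x - 1)" using r that elim(2) by (simp add: B_def)
      then show ?thesis by blast
    qed
    then show ?case by (auto simp: B_def)
  qed
  have AC: "AE x in N. x \<in> A \<longleftrightarrow> x \<in> (\<Union>t. C t)"
    using poincare_recurrence[OF A, of 1] AE_space
  proof eventually_elim
    case (elim x)
    have "x \<in> (\<Union>t. C t)" if "x \<in> A"
    proof -
      define q where "q = (LEAST t. t > 0 \<and> T (int t) x \<in> A)"
      have ex: "\<exists>t. t > 0 \<and> T (int t) x \<in> A" using elim that by auto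
      have q: "q > 0 \<and> T (int q) x \<in> A" unfolding q_def by (rule LeastI_ex[OF ex])
      have "T (int s) x \<notin> A" if "0 < s" "s < q" for s
        using not_less_Least[of s "\<lambda>t. t > 0 \<and> T (int t) x \<in> A"] that by (auto simp: q_def)
      then have "x \<in> C (q - 1)" using q that elim(2) by (simp add: C_def)
      then show ?thesis by blast
    qed
    then show ?case by (auto simp: C_def)
  qed
  have int: "set_integrable N S h" if "S \<in> sets N" "h \<in> borel_measurable N" "\<And>x. \<bar>h x\<bar> \<le> K" for S and h :: "'b \<Rightarrow> real"
    unfolding set_integrable_def
    by (intro integrable_mult_indicator that integrable_const_bound[where B=K]) (auto simp: that)
  have BC: "(LINT x:B t|N. g (T (- int (r x)) x)) = (LINT x:C t|N. g x)" for t
  proof -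
    \<comment> \<open>Between \<open>x\<close> and its translate by \<open>- (t + 1)\<close> lie the same points, met in the opposite order.\<close>
    have flip: "indicat_real (B t) x = indicat_real (C t) (T (- int (Suc t)) x)" if x: "x \<in> space N" for x
    proof -
      have c: "T (int s) (T (- int (Suc t)) x) = T (int s - int (Suc t)) x" "T (int q - int q) x = x" for s q
        by (simp_all only: T_add T_zero add.commute[of _ "- int (Suc t)"] uminus_add_conv_diff diff_self)
      have "(\<forall>s\<in>{0<..<Suc t}. T (- int s) x \<notin> A) \<longleftrightarrow>
            (\<forall>s\<in>{0<..<Suc t}. T (int s - int (Suc t)) x \<notin> A)"
      proof (intro iffI ballI)
        fix s assume *: "\<forall>s\<in>{0<..<Suc t}. T (- int s) x \<notin> A" "s \<in> {0<..<Suc t}"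
        then have "Suc t - s \<in> {0<..<Suc t}" by auto
        with *(1) have "T (- int (Suc t - s)) x \<notin> A" by blast
        moreover have "- int (Suc t - s) = int s - int (Suc t)" using * by (simp add: of_nat_diff)
        ultimately show "T (int s - int (Suc t)) x \<notin> A" by metis
      next
        fix s assume *: "\<forall>s\<in>{0<..<Suc t}. T (int s - int (Suc t)) x \<notin> A" "s \<in> {0<..<Suc t}"
        then have "Suc t - s \<in> {0<..<Suc t}" by auto
        with *(1) have "T (int (Suc t - s) - int (Suc t)) x \<notin> A" by blast
        moreover have "int (Suc t - s) - int (Suc t) = - int s" using * by (simp add: of_nat_diff)
        ultimately show "T (- int s) x \<notin> A" by metis
      qed
      moreover have "T (- int (Suc t)) x \<in> space N" using x measurable_space[OF T_measurable] by blast
      ultimately have "x \<in> B t \<longleftrightarrow> T (- int (Suc t)) x \<in> C t"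
        unfolding B_def C_def mem_Collect_eq c by (auto simp only: x)
      then show ?thesis by (simp add: indicator_def)
    qed
    have "(LINT x:B t|N. g (T (- int (r x)) x)) = (\<integral>x. indicat_real (C t) (T (- int (Suc t)) x) * g (T (- int (Suc t)) x) \<partial>N)"
      unfolding set_lebesgue_integral_def
    proof (rule Bochner_Integration.integral_cong[OF refl])
      fix x assume x: "x \<in> space N"
      show "indicat_real (B t) x *\<^sub>R g (T (- int (r x)) x)
          = indicat_real (C t) (T (- int (Suc t)) x) * g (T (- int (Suc t)) x)"
        unfolding flip[OF x, symmetric] using rB[of x t] by (cases "x \<in> B t") auto
    qed
    also have "\<dots> = (\<integral>x. indicat_real (C t) x * g x \<partial>N)"
      by (rule integral_T) measurable
    finally show ?thesis by (simp add: set_lebesgue_integral_def)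
  qed
  have "(LINT x:A|N. g (T (- int (r x)) x)) = (LINT x:(\<Union>t. B t)|N. g (T (- int (r x)) x))"
    unfolding set_lebesgue_integral_def using AB
    by (intro integral_cong_AE) (auto elim!: eventually_mono simp: indicator_def)
  also have "\<dots> = (\<Sum>t. (LINT x:B t|N. g (T (- int (r x)) x)))"
    by (rule lebesgue_integral_countable_add) (auto simp: B_disj intro!: int bounded)
  also have "\<dots> = (\<Sum>t. (LINT x:C t|N. g x))" by (simp only: BC)
  also have "\<dots> = (LINT x:(\<Union>t. C t)|N. g x)"
    by (rule lebesgue_integral_countable_add[symmetric]) (auto simp: C_disj intro!: int bounded)
  also have "\<dots> = (LINT x:A|N. g x)"
    unfolding set_lebesgue_integral_def using AC
    by (intro integral_cong_AE) (auto elim!: eventually_mono simp: indicator_def)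
  finally show ?thesis by (simp add: r_def)
qed

end

section \<open>The value at the return time, given the quantized past\<close>

abbreviation shift_path :: "int \<Rightarrow> (int \<Rightarrow> real) \<Rightarrow> (int \<Rightarrow> real)" where
  "shift_path m x \<equiv> (\<lambda>n. x (n + m))"

lemma space_path_space: "space path_space = UNIV"
  by (simp add: space_PiM PiE_UNIV_domain)

lemma set_integral_over_fibres:
  fixes C :: "'b \<Rightarrow> 'c :: countable" and f g :: "'b \<Rightarrow> real"
  assumes C: "C \<in> N \<rightarrow>\<^sub>M count_space UNIV" and f: "integrable N f" and g: "integrable N g"
    and fibre: "\<And>b. (LINT x:{x\<in>space N. C x = b}|N. f x) = (LINT x:{x\<in>space N. C x = b}|N. g x)"
  shows "(LINT x:{x\<in>space N. C x \<in> S}|N. f x) = (LINT x:{x\<in>space N. C x \<in> S}|N. g x)"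
proof -
  define A where "A i = {x\<in>space N. C x \<in> S \<and> to_nat (C x) = i}" for i :: nat
  have fib: "{x\<in>space N. C x \<in> B} \<in> sets N" for B
    using measurable_sets[OF C, of B] by (simp add: vimage_def Int_def conj_commute)
  have A_fib: "A i = {x\<in>space N. C x \<in> {b\<in>S. to_nat b = i}}" for i by (auto simp: A_def)
  have A: "A i \<in> sets N" for i unfolding A_fib by (rule fib)
  have disj: "i \<noteq> j \<Longrightarrow> A i \<inter> A j = {}" for i j by (auto simp: A_def)
  have UN: "(\<Union>i. A i) = {x\<in>space N. C x \<in> S}" by (auto simp: A_def)
  have int: "set_integrable N B h" if "B \<in> sets N" "integrable N h" for B and h :: "'b \<Rightarrow> real"
    unfolding set_integrable_def using that by (rule integrable_mult_indicator)
  have eq: "(LINT x:A i|N. f x) = (LINT x:A i|N. g x)" for i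
  proof (cases "A i = {}")
    case False
    then obtain x where x: "x \<in> space N" "C x \<in> S" "to_nat (C x) = i" by (auto simp: A_def)
    then have "A i = {y\<in>space N. C y = C x}" by (auto simp: A_def)
    then show ?thesis using fibre by simp
  qed (simp add: set_lebesgue_integral_def)
  have "(LINT x:{x\<in>space N. C x \<in> S}|N. f x) = (\<Sum>i. (LINT x:A i|N. f x))"
    unfolding UN[symmetric] using A f by (intro lebesgue_integral_countable_add disj int sets.countable_UN) auto
  also have "\<dots> = (\<Sum>i. (LINT x:A i|N. g x))" by (simp only: eq)
  also have "\<dots> = (LINT x:{x\<in>space N. C x \<in> S}|N. g x)"
    unfolding UN[symmetric] using A g
    by (intro lebesgue_integral_countable_add[symmetric] disj int sets.countable_UN) auto
  finally show ?thesis .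
qed

locale quantized_stationary_process = prob_space M + refining_partitions P
  for M :: "'a measure" and P :: "nat \<Rightarrow> real set set" +
  fixes X :: "int \<Rightarrow> 'a \<Rightarrow> real" and D :: real
  assumes X [measurable]: "\<And>n. X n \<in> borel_measurable M"
    and stationary: "stationary M X"
    and bounded: "AE \<omega> in M. \<bar>X 0 \<omega>\<bar> \<le> D"
begin

definition trajectory :: "'a \<Rightarrow> int \<Rightarrow> real" where "trajectory \<omega> = (\<lambda>n. X n \<omega>)"

definition law :: "(int \<Rightarrow> real) measure" where "law = distr M path_space trajectory"

lemma measurable_trajectory [measurable]: "trajectory \<in> M \<rightarrow>\<^sub>M path_space"
  by (rule measurable_abs_UNIV) (simp add: trajectory_def X)

lemma sets_law [measurable_cong]: "sets law = sets path_space" and space_law: "space law = UNIV"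
  by (simp_all add: law_def space_path_space)

lemma measurable_coordinate [measurable]: "(\<lambda>x. x n) \<in> borel_measurable law"
  unfolding law_def by simp

lemma measurable_shift: "shift_path m \<in> law \<rightarrow>\<^sub>M path_space"
  by (rule measurable_abs_UNIV) measurable

lemma prob_space_law: "prob_space law"
  unfolding law_def by (rule prob_space_distr) simp

sublocale law: measure_preserving_action law shift_path
proof (intro measure_preserving_action.intro measure_preserving_action_axioms.intro prob_space_law)
  show m: "shift_path m \<in> law \<rightarrow>\<^sub>M law" for m
    using measurable_shift measurable_cong_sets[OF refl sets_law] by blast
  show "distr law law (shift_path m) = law" for m
  proof -
    have "distr law law (shift_path m) = distr M law (\<lambda>\<omega>. shift_path m (trajectory \<omega>))"
      unfolding law_def by (subst distr_distr) (use m[of m] in \<open>auto simp: law_def comp_def\<close>)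
    also have "\<dots> = distr M path_space (\<lambda>\<omega> n. X (n + m) \<omega>)"
      by (rule distr_cong) (auto simp: sets_law trajectory_def)
    also have "\<dots> = law"
      using stationary unfolding stationary_def law_def trajectory_def by blast
    finally show ?thesis .
  qed
  show "shift_path a (shift_path b x) = shift_path (a + b) x" for a b x
    by (rule ext) (simp only: add.assoc)
  show "shift_path 0 x = x" for x by simp
qed

lemma AE_law: "(AE x in law. Q x) \<Longrightarrow> AE \<omega> in M. Q (trajectory \<omega>)"
  unfolding law_def by (rule AE_distrD[OF measurable_trajectory])

lemma integral_law:
  fixes f :: "(int \<Rightarrow> real) \<Rightarrow> real"
  assumes "f \<in> borel_measurable law"
  shows "(\<integral>x. f x \<partial>law) = (\<integral>\<omega>. f (trajectory \<omega>) \<partial>M)"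
proof -
  have "f \<in> borel_measurable path_space" using assms measurable_cong_sets[OF sets_law refl] by blast
  then show ?thesis unfolding law_def by (rule integral_distr[OF measurable_trajectory])
qed

lemma all_bounded: "AE \<omega> in M. \<forall>n. \<bar>X n \<omega>\<bar> \<le> D"
  unfolding AE_all_countable
proof
  fix n
  let ?B = "{x\<in>space law. \<bar>x 0\<bar> \<le> D}"
  have B [measurable]: "?B \<in> sets law" by measurable
  have "measure law ?B = measure M (trajectory -` ?B \<inter> space M)"
    using measure_distr[OF measurable_trajectory, of ?B] B unfolding sets_law law_def[symmetric] by blast
  also have "trajectory -` ?B \<inter> space M = {\<omega>\<in>space M. \<bar>X 0 \<omega>\<bar> \<le> D}"
    by (auto simp: trajectory_def space_law)
  also have "measure M {\<omega>\<in>space M. \<bar>X 0 \<omega>\<bar> \<le> D} = 1" using bounded by (subst prob_Collect_eq_1) auto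
  finally have "measure law {x\<in>space law. shift_path n x \<in> ?B} = 1" by (simp only: law.measure_T[OF B])
  then have "AE x in law. shift_path n x \<in> ?B" by (subst (asm) law.prob_Collect_eq_1) auto
  from AE_law[OF this] show "AE \<omega> in M. \<bar>X n \<omega>\<bar> \<le> D"
    by eventually_elim (auto simp: trajectory_def)
qed

lemma D_nonneg: "D \<ge> 0"
proof (rule ccontr)
  assume "\<not> D \<ge> 0"
  then have "AE \<omega> in M. False" by (intro eventually_mono[OF bounded]) auto
  then show False by simp
qed

lemma measurable_cells_law: "cells k l \<in> law \<rightarrow>\<^sub>M count_space UNIV"
  using measurable_cells[where N=law and Y="\<lambda>n x. x n" and k=k and l=l] measurable_coordinate by simp

lemma measurable_code_law: "code k \<in> law \<rightarrow>\<^sub>M count_space UNIV"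
  using measurable_code[where N=law and Y="\<lambda>n x. x n" and k=k] measurable_coordinate by simp

lemma returns_iff_cells: "returns (P (Suc k)) x l t \<longleftrightarrow> t > 0 \<and> cells k l (shift_path (- int t) x) = cells k l x"
  unfolding returns_def cells_eq_iff agree_def by simp

text \<open>For each of the countably many patterns, Poincare recurrence is applied to the cylinder of paths
  that show it.\<close>

lemma AE_recurrent: "AE x in law. recurrent x"
proof -
  have "AE x in law. \<forall>k l b. cells k l x = b \<longrightarrow> (\<exists>t. returns (P (Suc k)) x l t)"
    unfolding AE_all_countable
  proof (intro allI)
    fix k l b
    have "{x. cells k l x = b} = cells k l -` {b} \<inter> space law" by (auto simp: space_law)
    also have "\<dots> \<in> sets law" using measurable_cells_law by (rule measurable_sets) simp
    finally show "AE x in law. cells k l x = b \<longrightarrow> (\<exists>t. returns (P (Suc k)) x l t)"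
      by (intro eventually_mono[OF law.poincare_recurrence[of _ "-1"]]) (auto simp: returns_iff_cells)
  qed
  then show ?thesis by eventually_elim (auto simp: recurrent_def)
qed

text \<open>On recurrent paths the fibre of the code is a cylinder \<open>A\<close> of fixed length, and the return time is
  the first return time to \<open>A\<close> under the backward shift.\<close>

lemma conditional_law_of_return_fibre:
  fixes \<phi> :: "real \<Rightarrow> real"
  assumes \<phi> [measurable]: "\<phi> \<in> borel_measurable borel" and K: "\<And>u. \<bar>\<phi> u\<bar> \<le> K"
  shows "(LINT x:{x\<in>space law. code k x = b}|law. \<phi> (x (- int (tau P x (Suc k)))))
       = (LINT x:{x\<in>space law. code k x = b}|law. \<phi> (x 0))"
proof (cases "\<exists>x0. recurrent x0 \<and> code k x0 = b")
  case False
  have "AE x in law. x \<notin> {x\<in>space law. code k x = b}"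
    using AE_recurrent by eventually_elim (use False in auto)
  then have "AE x in law. indicat_real {x\<in>space law. code k x = b} x = 0" by eventually_elim simp
  then have "(LINT x:{x\<in>space law. code k x = b}|law. h x) = 0" for h :: "_ \<Rightarrow> real"
    unfolding set_lebesgue_integral_def by (intro integral_eq_zero_AE) (auto elim!: eventually_mono)
  then show ?thesis by simp
next
  case True
  then obtain x0 where x0: "recurrent x0" "code k x0 = b" by blast
  define l where "l = lam P x0 k"
  define A where "A = {x. cells k l x = cells k l x0}"
  have A: "A \<in> sets law"
  proof -
    have "A = cells k l -` {cells k l x0} \<inter> space law" by (auto simp: A_def space_law)
    also have "\<dots> \<in> sets law" using measurable_cells_law by (rule measurable_sets) simp
    finally show ?thesis .
  qed
  have code_A: "code k x = b \<longleftrightarrow> x \<in> A" if "recurrent x" for x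
    using code_eq_iff[OF x0(1) that, of k] x0(2) cells_eq_iff[of k l x0 x]
    by (auto simp: A_def l_def)
  have tau_A: "tau P x (Suc k) = (LEAST t. t > 0 \<and> shift_path (- int t) x \<in> A)" if "x \<in> A" for x
  proof -
    have "lam P x k = l"
      using that lam_determined[OF x0(1), of k x k] cells_eq_iff[of k l x0 x] by (simp add: A_def l_def)
    then have "tau P x (Suc k) = (LEAST t. returns (P (Suc k)) x l t)"
      by (simp add: tau_def recurrence_time_eq_Least)
    also have "\<dots> = (LEAST t. t > 0 \<and> shift_path (- int t) x \<in> A)"
      using that by (simp add: returns_iff_cells A_def)
    finally show ?thesis .
  qed
  have to_A: "(LINT x:{x\<in>space law. code k x = b}|law. h x) = (LINT x:A|law. h x)" if "h \<in> borel_measurable law" for h :: "_ \<Rightarrow> real"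
  proof -
    have "{x\<in>space law. code k x = b} = code k -` {b} \<inter> space law" by auto
    also have "\<dots> \<in> sets law" using measurable_code_law by (rule measurable_sets) simp
    finally have "{x\<in>space law. code k x = b} \<in> sets law" .
    moreover have "AE x in law. indicat_real {x\<in>space law. code k x = b} x *\<^sub>R h x = indicat_real A x *\<^sub>R h x"
      using AE_recurrent by eventually_elim (simp add: code_A space_law indicator_def)
    ultimately show ?thesis unfolding set_lebesgue_integral_def
      by (intro integral_cong_AE borel_measurable_scaleR borel_measurable_indicator A that)
  qed
  have "(\<lambda>x. x (- int (tau P x (Suc k)))) \<in> borel_measurable law"
    by (rule measurable_compose_countable[where f="\<lambda>t x. x (- int t)" and g="\<lambda>x. tau P x (Suc k)"])
       (use measurable_tau[where N=law and Y="\<lambda>n x. x n" and k=k] measurable_coordinate in simp_all)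
  then have "(LINT x:{x\<in>space law. code k x = b}|law. \<phi> (x (- int (tau P x (Suc k)))))
      = (LINT x:A|law. \<phi> (x (- int (tau P x (Suc k)))))"
    by (intro to_A) (rule measurable_compose[OF _ \<phi>])
  also have "\<dots> = (LINT x:A|law. \<phi> (shift_path (- int (LEAST t. t > 0 \<and> shift_path (- int t) x \<in> A)) x 0))"
    using tau_A by (intro set_lebesgue_integral_cong A) auto
  also have "\<dots> = (LINT x:A|law. \<phi> (x 0))"
    using law.first_return_preserves_integral[where g="\<lambda>x. \<phi> (x 0)", OF A measurable_compose[OF measurable_coordinate \<phi>] K]
    by blast
  also have "\<dots> = (LINT x:{x\<in>space law. code k x = b}|law. \<phi> (x 0))"
    by (rule to_A[symmetric]) (rule measurable_compose[OF measurable_coordinate \<phi>])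
  finally show ?thesis .
qed

definition F :: "nat \<Rightarrow> 'a measure" where
  "F k = vimage_algebra (space M) (\<lambda>\<omega>. code k (trajectory \<omega>)) (count_space UNIV)"

lemma sets_F: "sets (F k) = {{\<omega>\<in>space M. code k (trajectory \<omega>) \<in> S} |S. True}"
  unfolding F_def by (subst sets_vimage_algebra2) (auto simp: vimage_def Int_def conj_commute)

text \<open>Every set of codes is admitted, so a function of the code is measurable whatever its target.\<close>

lemma measurable_F_if_determined:
  assumes "\<And>\<omega> \<omega>'. code k (trajectory \<omega>) = code k (trajectory \<omega>') \<Longrightarrow> f \<omega> = f \<omega>'"
    and "\<And>\<omega>. f \<omega> \<in> space N"
  shows "f \<in> F k \<rightarrow>\<^sub>M N"
proof (rule measurableI)
  fix A assume "A \<in> sets N"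
  have "f -` A \<inter> space (F k) = {\<omega>\<in>space M. code k (trajectory \<omega>) \<in> (\<lambda>\<omega>. code k (trajectory \<omega>)) ` (f -` A)}"
  proof (intro set_eqI iffI)
    fix \<omega> assume "\<omega> \<in> {\<omega>\<in>space M. code k (trajectory \<omega>) \<in> (\<lambda>\<omega>. code k (trajectory \<omega>)) ` (f -` A)}"
    then obtain \<omega>' where "\<omega> \<in> space M" "code k (trajectory \<omega>) = code k (trajectory \<omega>')" "f \<omega>' \<in> A" by blast
    then show "\<omega> \<in> f -` A \<inter> space (F k)" using assms(1)[of \<omega> \<omega>'] by (simp add: F_def)
  qed (simp add: F_def)
  then show "f -` A \<inter> space (F k) \<in> sets (F k)" unfolding sets_F by blast
qed (use assms(2) in auto)

lemma sets_F_le: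
  assumes "\<And>i. i < 0 \<Longrightarrow> X i \<in> borel_measurable N" "space N = space M"
  shows "sets (F k) \<subseteq> sets N"
proof
  fix A assume "A \<in> sets (F k)"
  then obtain S where "A = {\<omega>\<in>space M. code k (trajectory \<omega>) \<in> S}" by (auto simp: sets_F)
  then have "A = (\<lambda>\<omega>. code k (trajectory \<omega>)) -` S \<inter> space N" using assms(2) by auto
  also have "\<dots> \<in> sets N"
    using measurable_code[where N=N and Y=X and k=k, OF assms(1)] by (intro measurable_sets) (auto simp: trajectory_def)
  finally show "A \<in> sets N" .
qed

sublocale discrete_filtration M F
proof
  show "subalgebra M (F n)" for n
    using sets_F_le[of M n] by (auto simp: subalgebra_def F_def)
  show "sets (F n) \<subseteq> sets (F (Suc n))" for n
  proof
    fix A assume "A \<in> sets (F n)"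
    then obtain S where A: "A = {\<omega>\<in>space M. code n (trajectory \<omega>) \<in> S}" by (auto simp: sets_F)
    have "(\<lambda>\<omega>. code n (trajectory \<omega>)) \<in> F (Suc n) \<rightarrow>\<^sub>M count_space UNIV"
      by (rule measurable_F_if_determined) (auto dest: code_mono)
    from measurable_sets[OF this, of S] show "A \<in> sets (F (Suc n))"
      by (simp add: A F_def vimage_def Int_def conj_commute)
  qed
qed

lemma AE_recurrent_trajectory: "AE \<omega> in M. recurrent (trajectory \<omega>)"
  by (rule AE_law[OF AE_recurrent])

definition quantized :: "nat \<Rightarrow> 'a \<Rightarrow> real" where
  "quantized k \<omega> = cell_point D (P (Suc k)) (X 0 \<omega>)"

text \<open>The default value 0 makes this a function of the next code on all paths.\<close>

definition quantized_return :: "nat \<Rightarrow> 'a \<Rightarrow> real" where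
  "quantized_return k \<omega> = (if recurrent (trajectory \<omega>)
     then cell_point D (P (Suc k)) (trajectory \<omega> (- int (tau P (trajectory \<omega>) (Suc k)))) else 0)"

lemma quantized_return_adapted: "quantized_return k \<in> borel_measurable (F (Suc k))"
proof (rule measurable_F_if_determined)
  fix \<omega> \<omega>'
  assume eq: "code (Suc k) (trajectory \<omega>) = code (Suc k) (trajectory \<omega>')"
  show "quantized_return k \<omega> = quantized_return k \<omega>'"
    using code_determines(1)[OF eq] code_determines_return[OF eq]
    by (auto simp: quantized_return_def cell_point_def)
qed simp

lemma quantized_measurable [measurable]: "quantized k \<in> borel_measurable M"
  unfolding quantized_def by (rule measurable_compose[OF X cell_point_borel])

lemma quantized_return_measurable [measurable]: "quantized_return k \<in> borel_measurable M"
  by (rule measurable_F[OF quantized_return_adapted])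

lemma quantized_bounded: "\<bar>quantized k \<omega>\<bar> \<le> D" and quantized_return_bounded: "\<bar>quantized_return k \<omega>\<bar> \<le> D"
  using cell_point_bounded[OF D_nonneg] D_nonneg by (auto simp: quantized_def quantized_return_def)

lemma integrable_quantized: "integrable M (quantized k)"
  by (rule integrable_const_bound[where B=D, OF AE_I2 quantized_measurable]) (simp add: quantized_bounded)

lemma integrable_quantized_return: "integrable M (quantized_return k)"
  by (rule integrable_const_bound[where B=D, OF AE_I2 quantized_return_measurable])
    (simp add: quantized_return_bounded)

lemma integrable_X0: "integrable M (X 0)"
  by (rule integrable_const_bound[where B=D, OF _ X]) (simp add: bounded)

lemma measurable_trajectory_law: "trajectory \<in> M \<rightarrow>\<^sub>M law"
  using measurable_trajectory measurable_cong_sets[OF refl sets_law] by blast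

text \<open>The equality on single fibres of the code is summed over the countably many codes.\<close>

lemma set_integral_quantized_return:
  assumes "A \<in> sets (F k)"
  shows "(LINT \<omega>:A|M. quantized_return k \<omega>) = (LINT \<omega>:A|M. quantized k \<omega>)"
proof -
  let ?\<phi> = "cell_point D (P (Suc k))"
  let ?ret = "\<lambda>x. ?\<phi> (x (- int (tau P x (Suc k))))"
  obtain S where A: "A = {\<omega>\<in>space M. code k (trajectory \<omega>) \<in> S}"
    using assms by (auto simp: sets_F)
  have A_M: "A \<in> sets M" using assms sub[of k] by (auto simp: subalgebra_def)
  define B where "B = {x\<in>space law. code k x \<in> S}"
  have B: "B \<in> sets law"
  proof -
    have "B = code k -` S \<inter> space law" by (auto simp: B_def)
    also have "\<dots> \<in> sets law" using measurable_code_law by (rule measurable_sets) simp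
    finally show ?thesis .
  qed
  have ret: "?ret \<in> borel_measurable law"
  proof -
    have "(\<lambda>x. x (- int (tau P x (Suc k)))) \<in> borel_measurable law"
      by (rule measurable_compose_countable[where f="\<lambda>t x. x (- int t)" and g="\<lambda>x. tau P x (Suc k)"])
         (use measurable_tau[where N=law and Y="\<lambda>n x. x n" and k=k] measurable_coordinate in simp_all)
    then show ?thesis by (rule measurable_compose[OF _ cell_point_borel])
  qed
  have now: "(\<lambda>x. ?\<phi> (x 0)) \<in> borel_measurable law"
    by (rule measurable_compose[OF measurable_coordinate cell_point_borel])
  have transfer: "(LINT x:B|law. f x) = (LINT \<omega>:A|M. f (trajectory \<omega>))"
    if "f \<in> borel_measurable law" for f :: "_ \<Rightarrow> real"
  proof -
    have "(LINT x:B|law. f x) = (\<integral>\<omega>. indicat_real B (trajectory \<omega>) *\<^sub>R f (trajectory \<omega>) \<partial>M)"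
      unfolding set_lebesgue_integral_def
      by (intro integral_law borel_measurable_scaleR borel_measurable_indicator B that)
    also have "\<dots> = (LINT \<omega>:A|M. f (trajectory \<omega>))"
      unfolding set_lebesgue_integral_def
      by (intro Bochner_Integration.integral_cong) (auto simp: A B_def space_law indicator_def)
    finally show ?thesis .
  qed
  have eq: "AE \<omega> in M. indicat_real A \<omega> *\<^sub>R quantized_return k \<omega> = indicat_real A \<omega> *\<^sub>R ?ret (trajectory \<omega>)"
    using AE_recurrent_trajectory by eventually_elim (simp add: quantized_return_def)
  have "(\<lambda>\<omega>. ?ret (trajectory \<omega>)) \<in> borel_measurable M"
    using measurable_compose[OF measurable_trajectory_law ret] .
  then have "(LINT \<omega>:A|M. quantized_return k \<omega>) = (LINT \<omega>:A|M. ?ret (trajectory \<omega>))"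
    unfolding set_lebesgue_integral_def using eq
    by (intro integral_cong_AE borel_measurable_scaleR borel_measurable_indicator A_M quantized_return_measurable)
  also have "\<dots> = (LINT x:B|law. ?ret x)" by (rule transfer[OF ret, symmetric])
  also have "\<dots> = (LINT x:B|law. ?\<phi> (x 0))"
    unfolding B_def
  proof (rule set_integral_over_fibres[OF measurable_code_law])
    show "integrable law ?ret"
      by (rule law.integrable_const_bound[where B=D, OF AE_I2 ret]) (simp add: cell_point_bounded D_nonneg)
    show "integrable law (\<lambda>x. ?\<phi> (x 0))"
      by (rule law.integrable_const_bound[where B=D, OF AE_I2 now]) (simp add: cell_point_bounded D_nonneg)
    show "(LINT x:{x\<in>space law. code k x = b}|law. ?ret x) = (LINT x:{x\<in>space law. code k x = b}|law. ?\<phi> (x 0))" for b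
      by (rule conditional_law_of_return_fibre[OF cell_point_borel cell_point_bounded[OF D_nonneg]])
  qed
  also have "\<dots> = (LINT \<omega>:A|M. quantized k \<omega>)"
    unfolding transfer[OF now] by (simp add: quantized_def trajectory_def)
  finally show ?thesis .
qed

lemma cond_exp_quantized_return:
  "AE \<omega> in M. real_cond_exp M (F k) (quantized_return k) \<omega> = real_cond_exp M (F k) (quantized k) \<omega>"
proof -
  interpret c: sigma_finite_subalgebra M "F k" by (rule subalgebra_sigma_finite)
  show ?thesis
  proof (rule c.real_cond_exp_charact)
    fix A assume A: "A \<in> sets (F k)"
    show "(LINT \<omega>:A|M. quantized_return k \<omega>) = (LINT \<omega>:A|M. real_cond_exp M (F k) (quantized k) \<omega>)"
      unfolding set_integral_quantized_return[OF A]
      by (rule c.real_cond_exp_intA[OF integrable_quantized A])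
  qed (intro integrable_quantized_return c.real_cond_exp_int(1) integrable_quantized borel_measurable_cond_exp)+
qed

text \<open>What the quantized value at the return time adds to its prediction from the quantized past.\<close>

definition innovation :: "nat \<Rightarrow> 'a \<Rightarrow> real" where
  "innovation k \<omega> = quantized_return k \<omega> - real_cond_exp M (F k) (quantized k) \<omega>"

lemma innovation_average: "AE \<omega> in M. (\<lambda>n. (\<Sum>j<n. innovation j \<omega>) / real n) \<longlonglongrightarrow> 0"
proof (rule bounded_martingale_difference_slln[where K="2 * D"])
  fix k
  interpret c: sigma_finite_subalgebra M "F k" by (rule subalgebra_sigma_finite)
  have E_F: "real_cond_exp M (F k) (quantized k) \<in> borel_measurable (F k)" by simp
  show "innovation k \<in> borel_measurable (F (Suc k))"
    unfolding innovation_def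
    by (intro borel_measurable_diff quantized_return_adapted measurable_F_mono[OF E_F]) simp
  have "AE \<omega> in M. real_cond_exp M (F k) (quantized k) \<omega> \<le> D"
    by (intro c.real_cond_exp_le_c integrable_quantized AE_I2) (use quantized_bounded in \<open>simp add: abs_le_iff\<close>)
  moreover have "AE \<omega> in M. real_cond_exp M (F k) (quantized k) \<omega> \<ge> - D"
    by (intro c.real_cond_exp_ge_c integrable_quantized AE_I2) (use quantized_bounded in \<open>simp add: abs_le_iff minus_le_iff\<close>)
  ultimately show "AE \<omega> in M. \<bar>innovation k \<omega>\<bar> \<le> 2 * D"
  proof eventually_elim
    case (elim \<omega>)
    then show ?case using quantized_return_bounded[of k \<omega>] unfolding innovation_def by linarith
  qed
  have "AE \<omega> in M. real_cond_exp M (F k) (innovation k) \<omega> =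
      real_cond_exp M (F k) (quantized_return k) \<omega> - real_cond_exp M (F k) (real_cond_exp M (F k) (quantized k)) \<omega>"
    unfolding innovation_def
    by (intro c.real_cond_exp_diff integrable_quantized_return c.real_cond_exp_int(1) integrable_quantized)
  moreover have "AE \<omega> in M. real_cond_exp M (F k) (real_cond_exp M (F k) (quantized k)) \<omega> = real_cond_exp M (F k) (quantized k) \<omega>"
    by (intro c.real_cond_exp_F_meas c.real_cond_exp_int(1) integrable_quantized E_F)
  ultimately show "AE \<omega> in M. real_cond_exp M (F k) (innovation k) \<omega> = 0"
    using cond_exp_quantized_return[of k] by eventually_elim simp
qed

lemma cond_exp_quantized_close:
  "AE \<omega> in M. \<bar>real_cond_exp M (F k) (quantized k) \<omega> - real_cond_exp M (F k) (X 0) \<omega>\<bar> \<le> mesh_error D k"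
proof -
  interpret c: sigma_finite_subalgebra M "F k" by (rule subalgebra_sigma_finite)
  have i: "integrable M (\<lambda>\<omega>. quantized k \<omega> - X 0 \<omega>)"
    using integrable_quantized integrable_X0 by (rule Bochner_Integration.integrable_diff)
  have close: "AE \<omega> in M. \<bar>quantized k \<omega> - X 0 \<omega>\<bar> \<le> mesh_error D k"
    using bounded by eventually_elim (simp add: quantized_def mesh_error_bound)
  have "AE \<omega> in M. real_cond_exp M (F k) (\<lambda>\<omega>. quantized k \<omega> - X 0 \<omega>) \<omega> \<le> mesh_error D k"
    by (rule c.real_cond_exp_le_c[OF i]) (use close in eventually_elim, simp add: abs_le_iff)
  moreover have "AE \<omega> in M. real_cond_exp M (F k) (\<lambda>\<omega>. quantized k \<omega> - X 0 \<omega>) \<omega> \<ge> - mesh_error D k"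
    by (rule c.real_cond_exp_ge_c[OF i]) (use close in eventually_elim, simp add: abs_le_iff)
  moreover have "AE \<omega> in M. real_cond_exp M (F k) (\<lambda>\<omega>. quantized k \<omega> - X 0 \<omega>) \<omega> =
      real_cond_exp M (F k) (quantized k) \<omega> - real_cond_exp M (F k) (X 0) \<omega>"
    by (rule c.real_cond_exp_diff[OF integrable_quantized integrable_X0])
  ultimately show ?thesis by eventually_elim (simp add: abs_le_iff)
qed

lemma R_eq: "R P (trajectory \<omega>) n = (\<Sum>j<n. trajectory \<omega> (- int (tau P (trajectory \<omega>) (Suc j)))) / real n"
  unfolding R_def by (simp add: sum.atLeast1_atMost_eq)

text \<open>The summand differs from the innovation plus \<open>E(X 0 | F j)\<close> by at most twice the mesh error: once
  for the value at the return time and once for the conditional expectation.\<close>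

lemma R_tendsto_F_inf: "AE \<omega> in M. (\<lambda>n. R P (trajectory \<omega>) n) \<longlonglongrightarrow> real_cond_exp M F_inf (X 0) \<omega>"
proof -
  have "AE \<omega> in M. \<forall>k. \<bar>real_cond_exp M (F k) (quantized k) \<omega> - real_cond_exp M (F k) (X 0) \<omega>\<bar> \<le> mesh_error D k"
    using cond_exp_quantized_close by (simp add: AE_all_countable)
  then show ?thesis
    using levy_upward[OF integrable_X0] innovation_average all_bounded AE_recurrent_trajectory
  proof eventually_elim
    case (elim \<omega>)
    define L where "L = real_cond_exp M F_inf (X 0) \<omega>"
    define y where "y j = trajectory \<omega> (- int (tau P (trajectory \<omega>) (Suc j)))" for j
    define E where "E j = real_cond_exp M (F j) (X 0) \<omega>" for j
    have "\<bar>y j - innovation j \<omega> - E j\<bar> \<le> 2 * mesh_error D j" for j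
    proof -
      have "\<bar>y j\<bar> \<le> D" using elim(4) by (simp add: y_def trajectory_def)
      then have "\<bar>quantized_return j \<omega> - y j\<bar> \<le> mesh_error D j"
        using mesh_error_bound[of "y j" D j] elim(5) by (simp add: quantized_return_def y_def)
      then show ?thesis using elim(1)[rule_format, of j] unfolding innovation_def E_def by linarith
    qed
    then have bound: "\<forall>\<^sub>F j in sequentially. norm (y j - innovation j \<omega> - E j) \<le> 2 * mesh_error D j"
      by simp
    have "(\<lambda>j. 2 * mesh_error D j) \<longlonglongrightarrow> 0"
      by (rule tendsto_mult_right_zero[OF mesh_error_tendsto_0[OF D_nonneg]])
    with bound have "(\<lambda>j. y j - innovation j \<omega> - E j) \<longlonglongrightarrow> 0"
      by (rule Lim_null_comparison)
    moreover have "E \<longlonglongrightarrow> L" using elim(2) unfolding E_def L_def .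
    ultimately have "(\<lambda>j. (y j - innovation j \<omega> - E j) + E j) \<longlonglongrightarrow> 0 + L" by (rule tendsto_add)
    then have "(\<lambda>j. y j - innovation j \<omega>) \<longlonglongrightarrow> L" by simp
    from tendsto_add[OF cesaro_limit[OF this] elim(3)]
    have "(\<lambda>n. (\<Sum>j<n. y j) / real n) \<longlonglongrightarrow> L"
      by (simp add: sum_subtractf diff_divide_distrib)
    then show ?case by (simp add: R_eq y_def L_def)
  qed
qed

section \<open>The limiting quantized past is the past\<close>

lemma past_measurable: "i < 0 \<Longrightarrow> X i \<in> borel_measurable (past M X)"
proof -
  assume "i < 0"
  then have i: "- 1 - int (nat (- 1 - i)) = i" by simp
  have "(\<lambda>\<omega> n. X (- 1 - int n) \<omega>) \<in> past M X \<rightarrow>\<^sub>M (\<Pi>\<^sub>M n\<in>(UNIV::nat set). borel)"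
    unfolding past_def by (rule measurable_vimage_algebra1) (auto simp: space_PiM)
  from measurable_compose[OF this measurable_component_singleton[of "nat (-1 - i)"]]
  show ?thesis by (simp only: i UNIV_I)
qed

lemma space_past: "space (past M X) = space M"
  by (simp add: past_def)

lemma subalgebra_past: "subalgebra M (past M X)"
proof -
  have "(\<lambda>\<omega> n. X (- 1 - int n) \<omega>) \<in> M \<rightarrow>\<^sub>M (\<Pi>\<^sub>M n\<in>(UNIV::nat set). borel)"
    by (rule measurable_abs_UNIV) (rule X)
  then have "sets (past M X) \<subseteq> sets M"
    unfolding past_def by (subst sets_vimage_algebra2) (auto simp: space_PiM intro: measurable_sets)
  then show ?thesis by (simp add: subalgebra_def space_past)
qed

lemma F_inf_le_past: "subalgebra (past M X) F_inf"
  by (intro F_inf_le sets_F_le past_measurable space_past)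

lemma recurrent_F_inf: "{\<omega>\<in>space M. recurrent (trajectory \<omega>)} \<in> sets F_inf"
proof -
  have "{\<omega>\<in>space M. recurrent (trajectory \<omega>)} = {\<omega>\<in>space M. code 0 (trajectory \<omega>) \<in> - {[]}}"
    by (auto simp: code_eq_Nil_iff)
  also have "\<dots> \<in> sets (F 0)" unfolding sets_F by blast
  finally show ?thesis using F_le_F_inf[of 0] by (auto simp: subalgebra_def)
qed

text \<open>On recurrent paths the window \<open>\<lambda>\<^sub>m\<close> is longer than \<open>m\<close>. Membership of \<open>X\<^sub>-\<^sub>i\<close> in a cell of level \<open>k\<close>
  is thus decided by the code of stage \<open>max i k\<close>, and the cells generate the Borel sets.\<close>

lemma coordinate_F_inf_measurable:
  assumes i: "1 \<le> i"
  shows "(\<lambda>\<omega>. if recurrent (trajectory \<omega>) then X (- int i) \<omega> else 0) \<in> borel_measurable F_inf"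
proof -
  let ?r = "{\<omega>\<in>space M. recurrent (trajectory \<omega>)}"
  let ?Z = "\<lambda>\<omega>. if recurrent (trajectory \<omega>) then X (- int i) \<omega> else 0"
  have r: "?r \<in> sets F_inf" by (rule recurrent_F_inf)
  have cell: "{\<omega>\<in>?r. X (- int i) \<omega> \<in> A} \<in> sets F_inf" if k: "1 \<le> k" and A: "A \<in> sigma_sets UNIV (P k)" for k A
  proof -
    define m where "m = max i k"
    have "(\<lambda>\<omega>. recurrent (trajectory \<omega>) \<and> X (- int i) \<omega> \<in> A) \<in> F m \<rightarrow>\<^sub>M count_space UNIV"
    proof (rule measurable_F_if_determined)
      fix \<omega> \<omega>' assume eq: "code m (trajectory \<omega>) = code m (trajectory \<omega>')"
      note d = code_determines[OF eq]
      have "X (- int i) \<omega> \<in> A \<longleftrightarrow> X (- int i) \<omega>' \<in> A" if rec: "recurrent (trajectory \<omega>)"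
      proof -
        have "i \<le> lam P (trajectory \<omega>) m" using lam_ge[OF rec, of m] by (simp add: m_def)
        then have "quantizer (P k) (trajectory \<omega> (- int i)) = quantizer (P k) (trajectory \<omega>' (- int i))"
          using d(3)[OF rec i _ k] by (simp add: m_def)
        then have q: "quantizer (P k) (X (- int i) \<omega>) = quantizer (P k) (X (- int i) \<omega>')"
          by (simp add: trajectory_def)
        show ?thesis
          using A
        proof (rule sigma_sets_indistinguishable)
          fix G assume "G \<in> P k"
          then show "X (- int i) \<omega> \<in> G \<longleftrightarrow> X (- int i) \<omega>' \<in> G"
            using q quantizer_mem[OF P_partition[OF k]] quantizer_eq[OF P_partition[OF k]] by metis
        qed
      qed
      then show "(recurrent (trajectory \<omega>) \<and> X (- int i) \<omega> \<in> A) = (recurrent (trajectory \<omega>') \<and> X (- int i) \<omega>' \<in> A)"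
        using d(1) by blast
    qed simp
    from measurable_sets[OF this, of "{True}"] have "{\<omega>\<in>?r. X (- int i) \<omega> \<in> A} \<in> sets (F m)"
      by (simp add: vimage_def Int_def conj_commute conj_left_commute)
    then show ?thesis using F_le_F_inf[of m] by (auto simp: subalgebra_def)
  qed
  have "?Z \<in> F_inf \<rightarrow>\<^sub>M sigma UNIV (\<Union>k\<in>{1..}. sigma_sets UNIV (P k))"
  proof (rule measurable_measure_of)
    fix A assume "A \<in> (\<Union>k\<in>{1..}. sigma_sets UNIV (P k))"
    then obtain k where "1 \<le> k" "A \<in> sigma_sets UNIV (P k)" by auto
    from cell[OF this] have c: "{\<omega>\<in>?r. X (- int i) \<omega> \<in> A} \<in> sets F_inf" .
    have "?Z -` A \<inter> space F_inf = {\<omega>\<in>?r. X (- int i) \<omega> \<in> A} \<union> (if 0 \<in> A then space F_inf - ?r else {})"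
      by (auto split: if_splits)
    also have "\<dots> \<in> sets F_inf" using c sets.compl_sets[OF r] by (auto simp del: space_F_inf)
    finally show "?Z -` A \<inter> space F_inf \<in> sets F_inf" .
  qed auto
  also have "F_inf \<rightarrow>\<^sub>M sigma UNIV (\<Union>k\<in>{1..}. sigma_sets UNIV (P k)) = F_inf \<rightarrow>\<^sub>M borel"
    using P by (intro measurable_cong_sets refl) (simp add: partition_sequence_def)
  finally show ?thesis .
qed

lemma past_le_F_inf:
  assumes "A \<in> sets (past M X)"
  shows "{\<omega>\<in>A. recurrent (trajectory \<omega>)} \<in> sets F_inf"
proof -
  let ?N = "\<Pi>\<^sub>M n\<in>(UNIV::nat set). (borel :: real measure)"
  obtain S where S: "S \<in> sets ?N" "A = (\<lambda>\<omega> n. X (- 1 - int n) \<omega>) -` S \<inter> space M"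
    using assms unfolding past_def by (subst (asm) sets_vimage_algebra2) (auto simp: space_PiM)
  let ?Z = "\<lambda>\<omega> n. if recurrent (trajectory \<omega>) then X (- int (Suc n)) \<omega> else 0"
  have "?Z \<in> F_inf \<rightarrow>\<^sub>M ?N"
    by (intro measurable_abs_UNIV coordinate_F_inf_measurable) simp
  then have "?Z -` S \<inter> space F_inf \<in> sets F_inf" using S(1) by (rule measurable_sets)
  then have "?Z -` S \<inter> space F_inf \<inter> {\<omega>\<in>space M. recurrent (trajectory \<omega>)} \<in> sets F_inf"
    using recurrent_F_inf by (rule sets.Int)
  also have "?Z -` S \<inter> space F_inf \<inter> {\<omega>\<in>space M. recurrent (trajectory \<omega>)} = {\<omega>\<in>A. recurrent (trajectory \<omega>)}"
    by (auto simp: S(2) algebra_simps)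
  finally show ?thesis .
qed

text \<open>Every event of the past, cut down to the recurrent paths, belongs to \<open>F_inf\<close>, and this removes only
  a null set. The averaging property that defines \<open>E(X 0 | F_inf)\<close> then holds for all events of the past.\<close>

lemma cond_exp_past: "AE \<omega> in M. real_cond_exp M (past M X) (X 0) \<omega> = real_cond_exp M F_inf (X 0) \<omega>"
proof -
  interpret p: finite_measure_subalgebra M "past M X" by unfold_locales (rule subalgebra_past)
  interpret i: finite_measure_subalgebra M F_inf by unfold_locales (rule subalgebra_F_inf)
  have EF: "real_cond_exp M F_inf (X 0) \<in> borel_measurable F_inf" by simp
  show ?thesis
  proof (rule p.real_cond_exp_charact[OF _ integrable_X0 i.real_cond_exp_int(1)[OF integrable_X0]])
    show "real_cond_exp M F_inf (X 0) \<in> borel_measurable (past M X)"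
      using EF by (rule measurable_from_subalg[OF F_inf_le_past])
    fix A assume A: "A \<in> sets (past M X)"
    define B where "B = {\<omega>\<in>A. recurrent (trajectory \<omega>)}"
    have B: "B \<in> sets F_inf" unfolding B_def by (rule past_le_F_inf[OF A])
    have M: "A \<in> sets M" "B \<in> sets M"
      using A B subalgebra_past subalgebra_F_inf by (auto simp: subalgebra_def)
    have swap: "(LINT \<omega>:A|M. f \<omega>) = (LINT \<omega>:B|M. f \<omega>)" if "f \<in> borel_measurable M" for f :: "'a \<Rightarrow> real"
    proof -
      have "AE \<omega> in M. indicat_real A \<omega> *\<^sub>R f \<omega> = indicat_real B \<omega> *\<^sub>R f \<omega>"
        using AE_recurrent_trajectory by eventually_elim (simp add: B_def indicator_def)
      then show ?thesis unfolding set_lebesgue_integral_def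
        by (intro integral_cong_AE borel_measurable_scaleR borel_measurable_indicator M that)
    qed
    have "(LINT \<omega>:A|M. X 0 \<omega>) = (LINT \<omega>:B|M. X 0 \<omega>)" by (rule swap[OF X])
    also have "\<dots> = (LINT \<omega>:B|M. real_cond_exp M F_inf (X 0) \<omega>)"
      by (rule i.real_cond_exp_intA[OF integrable_X0 B])
    also have "\<dots> = (LINT \<omega>:A|M. real_cond_exp M F_inf (X 0) \<omega>)"
      using measurable_from_subalg[OF subalgebra_F_inf EF] by (rule swap[symmetric])
    finally show "(LINT \<omega>:A|M. X 0 \<omega>) = (LINT \<omega>:A|M. real_cond_exp M F_inf (X 0) \<omega>)" .
  qed
qed

section \<open>The estimator along all times\<close>

text \<open>On a recurrent path \<open>k < \<lambda>\<^sub>k\<close>, so the maximum in \<open>\<kappa>\<^sub>t\<close> runs over a bounded set; it is at least \<open>k\<close> as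
  soon as \<open>t \<ge> \<lambda>\<^sub>k\<close>.\<close>

lemma kappa_at_top:
  assumes x: "recurrent x"
  shows "filterlim (kappa P x) at_top sequentially"
  unfolding filterlim_at_top
proof
  fix k
  show "eventually (\<lambda>t. k \<le> kappa P x t) sequentially"
  proof (rule eventually_sequentiallyI)
    fix t assume t: "lam P x k \<le> t"
    show "k \<le> kappa P x t"
      unfolding kappa_def
    proof (rule Greatest_le_nat[where P="\<lambda>k. lam P x k \<le> t"])
      show "y \<le> t" if "lam P x y \<le> t" for y
        using lam_ge[OF x, of y] that by simp
    qed (rule t)
  qed
qed

lemma R_hat_eq: "R_hat P x t = R P x (kappa P x t)"
  by (simp add: R_hat_def R_def)

theorem R_tendsto: "AE \<omega> in M. (\<lambda>n. R P (\<lambda>n. X n \<omega>) n) \<longlonglongrightarrow> real_cond_exp M (past M X) (X 0) \<omega>"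
  using R_tendsto_F_inf cond_exp_past by eventually_elim (simp add: trajectory_def)

theorem R_hat_tendsto: "AE \<omega> in M. (\<lambda>t. R_hat P (\<lambda>n. X n \<omega>) t) \<longlonglongrightarrow> real_cond_exp M (past M X) (X 0) \<omega>"
  using R_tendsto AE_recurrent_trajectory
proof eventually_elim
  case (elim \<omega>)
  then show ?case
    unfolding R_hat_eq using filterlim_compose[OF elim(1) kappa_at_top[OF elim(2)]]
    by (simp add: trajectory_def)
qed

end

theorem corollary1:
  fixes M :: "'a measure" and X :: "int \<Rightarrow> 'a \<Rightarrow> real"
    and P :: "nat \<Rightarrow> real set set" and D :: real
  assumes "prob_space M"
    and "\<And>n. X n \<in> borel_measurable M"
    and "stationary M X"
    and "ergodic M X"
    and "AE \<omega> in M. \<bar>X 0 \<omega>\<bar> \<le> D"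
    and "partition_sequence P"
  shows "(AE \<omega> in M. (\<lambda>k. R P (\<lambda>n. X n \<omega>) k)
              \<longlonglongrightarrow> real_cond_exp M (past M X) (X 0) \<omega>)
       \<and> (AE \<omega> in M. (\<lambda>t. R_hat P (\<lambda>n. X n \<omega>) t)
              \<longlonglongrightarrow> real_cond_exp M (past M X) (X 0) \<omega>)"
proof -
  interpret quantized_stationary_process M P X D
    using assms
    by (intro quantized_stationary_process.intro quantized_stationary_process_axioms.intro refining_partitions.intro)
  show ?thesis using R_tendsto R_hat_tendsto by blast
qed

end
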